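(* Let $P$ be a finite array TAOS, and let $R(P)$ be the nilpotent Lie algebra obtained from $P$, with its basis $B(P)$. Then there exists an inner product $\langle\cdot,\cdot\rangle$ on $R(P)$ satisfying: (i) $(R(P),\langle\cdot,\cdot\rangle)$ is an algebraic Ricci soliton with $\mathrm{Ric}=-\mathrm{id}+D$, where $D\in\mathrm{Der}(R(P))$ is diagonal with respect to $B(P)$; (ii) $B(P)$ is orthogonal with respect to $\langle\cdot,\cdot\rangle$; (iii) $\langle\cdot,\cdot\rangle$ is preserved by $\mathrm{Aut}(P)$.
   Context: A transitively and antisymmetrically ordered set (TAOS) is a set $P$ with a binary relation $\prec$ that is transitive and antisymmetric ($s\prec t$, $t\prec s$ imply $s=t$); it need be neither reflexive nor irreflexive. Lie algebra of a finite TAOS: $R(P)$ is the real vector space with basis $B(P)=\{(s,t)\mid s,t\in P,\ s\prec t\}\setminus\{(u,u)\mid u\in P,\ u\prec u\}$, with bilinear product determined by $(s,t)\cdot(u,v)=(s,v)$ if $t=u$ and $0$ if $t\ne u$, and Lie bracket $[x,y]=x\cdot y-y\cdot x$. $\mathrm{Aut}(P)$ is the group of bijections $f:P\to P$ such that $f$ and $f^{-1}$ are order-preserving ($x\prec y$ implies $f(x)\prec f(y)$). It acts on $B(P)$ by $f((s,t))=(f(s),f(t))$ and hence linearly on $R(P)$. Array TAOS: given integers $k\ge 2$, $n_1,\dots,n_k\ge 1$, and $m_1,\dots,m_k$ with $1\le m_i\le n_i$, $m_1=n_1$, $m_k=n_k$, let $P$ be a set with $\sum_{i=1}^k n_i$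 elements partitioned into $k$ columns, the $i$-th column having $n_i$ elements. For each $i=1,\dots,k-1$ choose $m_{i+1}$ elements of the $(i+1)$-th column and declare $\eta_i\prec\eta_{i+1}$ for each element $\eta_i$ of the $i$-th column and each of the $m_{i+1}$ chosen elements $\eta_{i+1}$ of the $(i+1)$-th column. The relation $\prec$ on $P$ is the transitive closure of these relations. Curvature of a metric Lie algebra $(\mathfrak g,\langle\cdot,\cdot\rangle)$ (a finite-dimensional real Lie algebra with inner product): the Levi-Civita connection $\nabla$ is defined by $2\langle\nabla_XY,Z\rangle=\langle[X,Y],Z\rangle+\langle[Z,X],Y\rangle+\langle X,[Z,Y]\rangle$; $R(X,Y)Z=\nabla_X\nabla_YZ-\nabla_Y\nabla_XZ-\nabla_{[X,Y]}Z$; and $\mathrm{Ric}(X)=\sum_i R(X,e_i)e_i$ for an orthonormal basis $\{e_i\}$. $\mathrm{Der}(\mathfrak g)$ is the set of derivations of $\mathfrak g$. $(\mathfrak g,\langle\cdot,\cdot\rangle)$ is an algebraic Ricci soliton if $\mathrm{Ric}=c\cdot\mathrm{id}+D$ for some $c\in\mathbb{R}$ and $D\in\mathrm{Der}(\mathfrak g)$. *)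

theory Defs
  imports "HOL-Analysis.Analysis" "HOL-Library.Poly_Mapping"
begin

section \<open>Transitively and antisymmetrically ordered sets\<close>

text \<open>A relation is a set of pairs: \<open>(s, t) \<in> r\<close> stands for \<open>s \<prec> t\<close>.\<close>

definition taos :: "'a set \<Rightarrow> 'a rel \<Rightarrow> bool" where
  "taos P r \<longleftrightarrow> r \<subseteq> P \<times> P \<and> trans r \<and> antisym r"

definition order_preserving_on :: "'a set \<Rightarrow> 'a rel \<Rightarrow> ('a \<Rightarrow> 'a) \<Rightarrow> bool" where
  "order_preserving_on P r f \<longleftrightarrow> (\<forall>x\<in>P. \<forall>y\<in>P. (x, y) \<in> r \<longrightarrow> (f x, f y) \<in> r)"

definition taos_aut :: "'a set \<Rightarrow> 'a rel \<Rightarrow> ('a \<Rightarrow> 'a) set" where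
  "taos_aut P r = {f. bij_betw f P P \<and> order_preserving_on P r f \<and>
     order_preserving_on P r (inv_into P f)}"

text \<open>\<open>C i\<close> is the \<open>i\<close>-th column and, for \<open>i \<ge> 2\<close>, \<open>M i\<close> is the set of the \<open>m i\<close> chosen
  elements of that column; \<open>C\<close>, \<open>M\<close>, \<open>n\<close> and \<open>m\<close> are irrelevant outside \<open>{1..k}\<close>, and so is \<open>M 1\<close>.\<close>

definition array_taos :: "nat \<Rightarrow> (nat \<Rightarrow> nat) \<Rightarrow> (nat \<Rightarrow> nat) \<Rightarrow> 'a set \<Rightarrow> 'a rel \<Rightarrow> bool" where
  "array_taos k n m P r \<longleftrightarrow>
     k \<ge> 2 \<and> (\<forall>i\<in>{1..k}. n i \<ge> 1 \<and> 1 \<le> m i \<and> m i \<le> n i) \<and> m 1 = n 1 \<and> m k = n k \<and>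
     (\<exists>C M. P = (\<Union>i\<in>{1..k}. C i) \<and> disjoint_family_on C {1..k} \<and>
        (\<forall>i\<in>{1..k}. finite (C i) \<and> card (C i) = n i) \<and>
        (\<forall>i\<in>{1..<k}. M (i + 1) \<subseteq> C (i + 1) \<and> card (M (i + 1)) = m (i + 1)) \<and>
        r = (\<Union>i\<in>{1..<k}. C i \<times> M (i + 1))\<^sup>+)"

lemma array_taos_imp_taos:
  assumes "array_taos k n m P r"
  shows "finite P" "taos P r"
proof -
  obtain C M where P: "P = (\<Union>i\<in>{1..k}. C i)" and disj: "disjoint_family_on C {1..k}"
    and fin: "\<forall>i\<in>{1..k}. finite (C i)" and M: "\<forall>i\<in>{1..<k}. M (i + 1) \<subseteq> C (i + 1)"
    and r: "r = (\<Union>i\<in>{1..<k}. C i \<times> M (i + 1))\<^sup>+"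
    using assms unfolding array_taos_def by blast
  show "finite P" using P fin by auto
  have column: "\<exists>i\<in>{1..k}. \<exists>j\<in>{1..k}. i < j \<and> x \<in> C i \<and> y \<in> C j" if "(x, y) \<in> r" for x y
    using that unfolding r
  proof (induction rule: trancl_induct)
    case (base y)
    then obtain i where "i \<in> {1..<k}" "x \<in> C i" "y \<in> M (i + 1)" by blast
    moreover from this have "y \<in> C (i + 1)" "i \<in> {1..k}" "i + 1 \<in> {1..k}" using M by auto
    ultimately show ?case by (intro bexI[of _ i] bexI[of _ "i + 1"]) auto
  next
    case (step y z)
    from step.hyps(2) obtain l where l: "l \<in> {1..<k}" "y \<in> C l" "z \<in> M (l + 1)" by blast
    from step.IH obtain i j where ij: "i \<in> {1..k}" "j \<in> {1..k}" "i < j" "x \<in> C i" "y \<in> C j"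
      by blast
    have "l \<in> {1..k}" using l(1) by simp
    then have "j = l" using disj ij(2,5) l(2) unfolding disjoint_family_on_def by blast
    moreover have "z \<in> C (l + 1)" "l + 1 \<in> {1..k}" using l(1,3) M by auto
    ultimately show ?case using ij(1,3,4) by (intro bexI[of _ i] bexI[of _ "l + 1"]) auto
  qed
  have "antisym r"
  proof (rule antisymI)
    fix x y assume "(x, y) \<in> r" "(y, x) \<in> r"
    then have "(x, x) \<in> r" unfolding r by (rule trancl_trans)
    from column[OF this] obtain i j where
      "i \<in> {1..k}" "j \<in> {1..k}" "i < j" "x \<in> C i" "x \<in> C j" by blast
    then have "i = j" using disj unfolding disjoint_family_on_def by blast
    with \<open>i < j\<close> show "x = y" by simp
  qed
  moreover have "r \<subseteq> P \<times> P" using column unfolding P by fast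
  moreover have "trans r" unfolding r by (rule trans_trancl)
  ultimately show "taos P r" unfolding taos_def by blast
qed

section \<open>Metric Lie algebras\<close>

text \<open>A Lie algebra is a subspace \<open>V\<close> of an ambient real vector space with a bracket \<open>br\<close>;
  brackets, inner products and derivations are constrained only on \<open>V\<close>.\<close>

definition linear_map_on :: "'v::real_vector set \<Rightarrow> ('v \<Rightarrow> 'w::real_vector) \<Rightarrow> bool" where
  "linear_map_on V f \<longleftrightarrow>
     (\<forall>x\<in>V. \<forall>y\<in>V. f (x + y) = f x + f y) \<and> (\<forall>a. \<forall>x\<in>V. f (a *\<^sub>R x) = a *\<^sub>R f x)"

definition bilinear_map_on :: "'v::real_vector set \<Rightarrow> ('v \<Rightarrow> 'v \<Rightarrow> 'w::real_vector) \<Rightarrow> bool" where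
  "bilinear_map_on V b \<longleftrightarrow>
     (\<forall>x\<in>V. linear_map_on V (b x)) \<and> (\<forall>y\<in>V. linear_map_on V (\<lambda>x. b x y))"

definition lie_algebra_on :: "'v::real_vector set \<Rightarrow> ('v \<Rightarrow> 'v \<Rightarrow> 'v) \<Rightarrow> bool" where
  "lie_algebra_on V br \<longleftrightarrow>
     subspace V \<and> (\<forall>x\<in>V. \<forall>y\<in>V. br x y \<in> V) \<and> bilinear_map_on V br \<and>
     (\<forall>x\<in>V. br x x = 0) \<and>
     (\<forall>x\<in>V. \<forall>y\<in>V. \<forall>z\<in>V. br x (br y z) + br y (br z x) + br z (br x y) = 0)"

definition inner_product_on :: "'v::real_vector set \<Rightarrow> ('v \<Rightarrow> 'v \<Rightarrow> real) \<Rightarrow> bool" where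
  "inner_product_on V ip \<longleftrightarrow>
     bilinear_map_on V ip \<and> (\<forall>x\<in>V. \<forall>y\<in>V. ip x y = ip y x) \<and> (\<forall>x\<in>V. x \<noteq> 0 \<longrightarrow> ip x x > 0)"

definition metric_lie_algebra_on ::
    "'v::real_vector set \<Rightarrow> ('v \<Rightarrow> 'v \<Rightarrow> 'v) \<Rightarrow> ('v \<Rightarrow> 'v \<Rightarrow> real) \<Rightarrow> bool" where
  "metric_lie_algebra_on V br ip \<longleftrightarrow>
     lie_algebra_on V br \<and> (\<exists>E. finite E \<and> span E = V) \<and> inner_product_on V ip"

definition levi_civita ::
    "'v::real_vector set \<Rightarrow> ('v \<Rightarrow> 'v \<Rightarrow> 'v) \<Rightarrow> ('v \<Rightarrow> 'v \<Rightarrow> real) \<Rightarrow> 'v \<Rightarrow> 'v \<Rightarrow> 'v" where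
  "levi_civita V br ip X Y = (THE W. W \<in> V \<and>
     (\<forall>Z\<in>V. 2 * ip W Z = ip (br X Y) Z + ip (br Z X) Y + ip X (br Z Y)))"

definition riemann_curvature ::
    "'v::real_vector set \<Rightarrow> ('v \<Rightarrow> 'v \<Rightarrow> 'v) \<Rightarrow> ('v \<Rightarrow> 'v \<Rightarrow> real) \<Rightarrow> 'v \<Rightarrow> 'v \<Rightarrow> 'v \<Rightarrow> 'v" where
  "riemann_curvature V br ip X Y Z =
     levi_civita V br ip X (levi_civita V br ip Y Z)
     - levi_civita V br ip Y (levi_civita V br ip X Z)
     - levi_civita V br ip (br X Y) Z"

definition orthonormal_basis_on ::
    "'v::real_vector set \<Rightarrow> ('v \<Rightarrow> 'v \<Rightarrow> real) \<Rightarrow> 'v set \<Rightarrow> bool" where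
  "orthonormal_basis_on V ip E \<longleftrightarrow>
     finite E \<and> independent E \<and> span E = V \<and>
     (\<forall>e\<in>E. \<forall>e'\<in>E. ip e e' = (if e = e' then 1 else 0))"

text \<open>For an inner product on a finite-dimensional \<open>V\<close> the value does not depend on which
  orthonormal basis is chosen.\<close>

definition ricci ::
    "'v::real_vector set \<Rightarrow> ('v \<Rightarrow> 'v \<Rightarrow> 'v) \<Rightarrow> ('v \<Rightarrow> 'v \<Rightarrow> real) \<Rightarrow> 'v \<Rightarrow> 'v" where
  "ricci V br ip X =
     (\<Sum>e\<in>(SOME E. orthonormal_basis_on V ip E). riemann_curvature V br ip X e e)"

definition derivations_on :: "'v::real_vector set \<Rightarrow> ('v \<Rightarrow> 'v \<Rightarrow> 'v) \<Rightarrow> ('v \<Rightarrow> 'v) set" where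
  "derivations_on V br = {D. (\<forall>x\<in>V. D x \<in> V) \<and> linear_map_on V D \<and>
     (\<forall>x\<in>V. \<forall>y\<in>V. D (br x y) = br (D x) y + br x (D y))}"

definition algebraic_ricci_soliton ::
    "'v::real_vector set \<Rightarrow> ('v \<Rightarrow> 'v \<Rightarrow> 'v) \<Rightarrow> ('v \<Rightarrow> 'v \<Rightarrow> real) \<Rightarrow> bool" where
  "algebraic_ricci_soliton V br ip \<longleftrightarrow>
     metric_lie_algebra_on V br ip \<and>
     (\<exists>c. \<exists>D\<in>derivations_on V br. \<forall>X\<in>V. ricci V br ip X = c *\<^sub>R X + D X)"

section \<open>The Lie algebra of a finite TAOS\<close>

text \<open>The ambient vector space is the free real vector space on all pairs, i.e. the finitely
  supported functions \<open>('a \<times> 'a) \<Rightarrow>\<^sub>0 real\<close>.\<close>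

instantiation poly_mapping :: (type, real_vector) real_vector
begin

definition scaleR_poly_mapping :: "real \<Rightarrow> ('a \<Rightarrow>\<^sub>0 'b) \<Rightarrow> ('a \<Rightarrow>\<^sub>0 'b)" where
  "scaleR_poly_mapping c x = Poly_Mapping.map (\<lambda>b. c *\<^sub>R b) x"

lemma lookup_scaleR [simp]:
  "Poly_Mapping.lookup (c *\<^sub>R (x :: 'a \<Rightarrow>\<^sub>0 'b)) p = c *\<^sub>R Poly_Mapping.lookup x p"
  unfolding scaleR_poly_mapping_def by (simp add: Poly_Mapping.map.rep_eq when_def)

instance
  by standard (rule poly_mapping_eqI,
      simp add: lookup_add scaleR_add_right scaleR_add_left)+

end

definition pair_vec :: "'a \<times> 'a \<Rightarrow> ('a \<times> 'a) \<Rightarrow>\<^sub>0 real" where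
  "pair_vec p = Poly_Mapping.single p 1"

definition taos_basis :: "'a set \<Rightarrow> 'a rel \<Rightarrow> ('a \<times> 'a) set" where
  "taos_basis P r = {(s, t). s \<in> P \<and> t \<in> P \<and> (s, t) \<in> r} - {(u, u) | u. u \<in> P \<and> (u, u) \<in> r}"

definition taos_space :: "'a set \<Rightarrow> 'a rel \<Rightarrow> (('a \<times> 'a) \<Rightarrow>\<^sub>0 real) set" where
  "taos_space P r = span (pair_vec ` taos_basis P r)"

text \<open>The product is defined on the whole ambient space; \<open>taos_space P r\<close> is closed under it
  because \<open>r\<close> is transitive and antisymmetric.\<close>

definition pair_mult :: "'a \<times> 'a \<Rightarrow> 'a \<times> 'a \<Rightarrow> ('a \<times> 'a) \<Rightarrow>\<^sub>0 real" where
  "pair_mult p q = (if snd p = fst q then pair_vec (fst p, snd q) else 0)"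

definition taos_mult ::
    "(('a \<times> 'a) \<Rightarrow>\<^sub>0 real) \<Rightarrow> (('a \<times> 'a) \<Rightarrow>\<^sub>0 real) \<Rightarrow> (('a \<times> 'a) \<Rightarrow>\<^sub>0 real)" where
  "taos_mult x y =
     (\<Sum>p\<in>Poly_Mapping.keys x. \<Sum>q\<in>Poly_Mapping.keys y.
        (Poly_Mapping.lookup x p * Poly_Mapping.lookup y q) *\<^sub>R pair_mult p q)"

definition taos_bracket ::
    "(('a \<times> 'a) \<Rightarrow>\<^sub>0 real) \<Rightarrow> (('a \<times> 'a) \<Rightarrow>\<^sub>0 real) \<Rightarrow> (('a \<times> 'a) \<Rightarrow>\<^sub>0 real)" where
  "taos_bracket x y = taos_mult x y - taos_mult y x"

definition taos_action ::
    "('a \<Rightarrow> 'a) \<Rightarrow> (('a \<times> 'a) \<Rightarrow>\<^sub>0 real) \<Rightarrow> (('a \<times> 'a) \<Rightarrow>\<^sub>0 real)" where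
  "taos_action f x = (\<Sum>p\<in>Poly_Mapping.keys x. Poly_Mapping.lookup x p *\<^sub>R pair_vec (map_prod f f p))"

end

theory Submission
  imports Defs
begin

text \<open>Give \<open>e\<^sub>s\<^sub>t\<close> the squared length \<open>w t\<close>, depending on the target only, where \<open>2 * w t\<close> is the number of
  elements below \<open>t\<close>, plus the number above \<open>t\<close>, plus the number of elements with the same lower and
  upper sets as \<open>t\<close>. These numbers are invariant under automorphisms. All brackets of basis
  vectors are multiples of basis vectors, the Killing form vanishes, and the Ricci operator is
  diagonal with eigenvalues
  \<open>\<rho> s t = ((\<Sum>s\<prec>x\<prec>t. 1 / w x) - (\<Sum>t\<prec>v. 1 / w t) - (\<Sum>u\<prec>s. 1 / w s)) / 2\<close>.
  For \<open>s \<prec> t \<prec> v\<close>, an \<open>x\<close> strictly between \<open>s\<close> and \<open>v\<close> that is incomparable to \<open>t\<close> lies in the column of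
  \<open>t\<close> and has the same lower and upper sets, so \<open>\<rho> s v = \<rho> s t + \<rho> t v + 1\<close>, which says that
  \<open>Ric + id\<close> is a derivation.\<close>

section \<open>Ricci curvature of a unimodular metric algebra\<close>

text \<open>Bracket and form are bilinear on the whole ambient space, so the library facts on total
  linear maps apply directly; only closure and the basis refer to \<open>V\<close>. Positivity of
  \<open>ip\<close> is derived from the orthonormal basis in \<open>inner_product\<close>.\<close>

locale metric_algebra =
  fixes V :: "'v::real_vector set" and br :: "'v \<Rightarrow> 'v \<Rightarrow> 'v" and ip :: "'v \<Rightarrow> 'v \<Rightarrow> real"
    and E :: "'v set"
  assumes bilinear_br: "bilinear br"
    and bilinear_ip: "bilinear ip"
    and br_closed: "x \<in> V \<Longrightarrow> y \<in> V \<Longrightarrow> br x y \<in> V"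
    and br_antisym: "br x y = - br y x"
    and ip_commute: "ip x y = ip y x"
    and orthonormal: "orthonormal_basis_on V ip E"
begin

section \<open>Coordinates in an orthonormal basis\<close>

lemma finite_E: "finite E" and span_E: "span E = V"
  and ip_E: "e \<in> E \<Longrightarrow> e' \<in> E \<Longrightarrow> ip e e' = (if e = e' then 1 else 0)"
  using orthonormal unfolding orthonormal_basis_on_def by auto

lemma E_in_V: "e \<in> E \<Longrightarrow> e \<in> V"
  using span_E span_base by blast

lemma subspace_V: "subspace V"
  using span_E subspace_span by blast

lemma linear_ip: "linear (ip x)" "linear (\<lambda>x. ip x y)"
  using bilinear_ip by (auto simp: bilinear_def)

lemmas br_linear_simps = bilinear_ladd[OF bilinear_br] bilinear_radd[OF bilinear_br]
  bilinear_lmul[OF bilinear_br] bilinear_rmul[OF bilinear_br]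

lemmas ip_linear_simps = bilinear_ladd[OF bilinear_ip] bilinear_radd[OF bilinear_ip]
  bilinear_lmul[OF bilinear_ip] bilinear_rmul[OF bilinear_ip]

lemma ip_sum_left: "ip (\<Sum>i\<in>A. f i) y = (\<Sum>i\<in>A. ip (f i) y)"
  using linear_sum[OF linear_ip(2)] .

lemma ip_expansion: "ip (\<Sum>e\<in>E. f e *\<^sub>R e) e' = f e'" if "e' \<in> E"
proof -
  have "ip (\<Sum>e\<in>E. f e *\<^sub>R e) e' = (\<Sum>e\<in>E. if e = e' then f e else 0)"
    using that unfolding ip_sum_left by (intro sum.cong) (simp_all add: ip_linear_simps ip_E)
  then show ?thesis using that finite_E by simp
qed

lemma orthonormal_expansion:
  assumes "x \<in> V"
  shows "x = (\<Sum>e\<in>E. ip x e *\<^sub>R e)"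
proof -
  have "linear (\<lambda>x. \<Sum>e\<in>E. ip x e *\<^sub>R e)"
    by (intro linearI)
       (simp_all add: ip_linear_simps scaleR_left_distrib sum.distrib scaleR_sum_right)
  moreover have "b = (\<Sum>e\<in>E. ip b e *\<^sub>R e)" if "b \<in> E" for b
  proof -
    have "(\<Sum>e\<in>E. ip b e *\<^sub>R e) = (\<Sum>e\<in>E. if b = e then e else 0)"
      using that by (intro sum.cong) (simp_all add: ip_E)
    then show ?thesis using that finite_E by simp
  qed
  ultimately show ?thesis
    using assms linear_eq_on[of "\<lambda>x. x" "\<lambda>x. \<Sum>e\<in>E. ip x e *\<^sub>R e" x E] linear_id
    by (auto simp: span_E id_def)
qed

lemma parseval: "x \<in> V \<Longrightarrow> ip x y = (\<Sum>e\<in>E. ip x e * ip e y)"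
  using arg_cong[OF orthonormal_expansion, of x "\<lambda>x. ip x y"]
  by (simp add: ip_sum_left ip_linear_simps)

lemma inner_product: "inner_product_on V ip"
proof -
  have "ip x x > 0" if "x \<in> V" "x \<noteq> 0" for x
  proof -
    obtain e where "e \<in> E" "ip x e \<noteq> 0"
      using orthonormal_expansion[OF \<open>x \<in> V\<close>] \<open>x \<noteq> 0\<close>
        sum.neutral[of E "\<lambda>e. ip x e *\<^sub>R e"] by force
    then have "0 < (\<Sum>e\<in>E. ip x e * ip x e)"
      using finite_E by (intro sum_pos2[of _ e]) (auto simp: zero_less_mult_iff)
    then show ?thesis using parseval[OF \<open>x \<in> V\<close>, of x] by (simp add: ip_commute)
  qed
  then show ?thesis
    unfolding inner_product_on_def bilinear_map_on_def linear_map_on_def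
    by (auto simp: ip_linear_simps intro: ip_commute)
qed

text \<open>Needed because \<open>ricci\<close> sums over a basis picked by \<open>SOME\<close>.
  Each \<open>f\<close> is expanded in \<open>E\<close>; summing over \<open>F\<close> first turns
  the coefficient of \<open>h d e\<close> into \<open>ip d e\<close>.\<close>

lemma trace_basis_independent:
  fixes h :: "'v \<Rightarrow> 'v \<Rightarrow> 'v"
  assumes h: "bilinear h" and F: "orthonormal_basis_on V ip F"
  shows "(\<Sum>f\<in>F. h f f) = (\<Sum>e\<in>E. h e e)"
proof -
  \<comment> \<open>A second instance of the locale supplies Parseval for \<open>F\<close>, which
    evaluates the sum over \<open>f\<close>.\<close>
  interpret F: metric_algebra V br ip F
    by unfold_locales (rule bilinear_br bilinear_ip br_antisym ip_commute F | erule (1) br_closed)+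
  have "(\<Sum>f\<in>F. h f f) = (\<Sum>f\<in>F. \<Sum>d\<in>E. \<Sum>e\<in>E. (ip f d * ip f e) *\<^sub>R h d e)"
  proof (rule sum.cong)
    fix f assume "f \<in> F"
    then have f: "f = (\<Sum>e\<in>E. ip f e *\<^sub>R e)"
      using orthonormal_expansion F.E_in_V by blast
    have "h f f = h (\<Sum>e\<in>E. ip f e *\<^sub>R e) (\<Sum>e\<in>E. ip f e *\<^sub>R e)"
      using arg_cong2[OF f f, of h] .
    also have "\<dots> = (\<Sum>d\<in>E. \<Sum>e\<in>E. (ip f d * ip f e) *\<^sub>R h d e)"
      by (simp add: bilinear_sum[OF h] bilinear_lmul[OF h] bilinear_rmul[OF h]
          sum.cartesian_product mult.commute)
    finally show "h f f = (\<Sum>d\<in>E. \<Sum>e\<in>E. (ip f d * ip f e) *\<^sub>R h d e)" .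
  qed simp
  also have "\<dots> = (\<Sum>d\<in>E. \<Sum>f\<in>F. \<Sum>e\<in>E. (ip f d * ip f e) *\<^sub>R h d e)"
    by (rule sum.swap)
  also have "\<dots> = (\<Sum>d\<in>E. \<Sum>e\<in>E. \<Sum>f\<in>F. (ip f d * ip f e) *\<^sub>R h d e)"
    by (intro sum.cong refl sum.swap)
  also have "\<dots> = (\<Sum>d\<in>E. \<Sum>e\<in>E. ip d e *\<^sub>R h d e)"
  proof (intro sum.cong refl)
    fix d e assume "d \<in> E"
    then have "ip d e = (\<Sum>f\<in>F. ip f d * ip f e)"
      using F.parseval[OF E_in_V, of d e] by (simp add: ip_commute[of d])
    then show "(\<Sum>f\<in>F. (ip f d * ip f e) *\<^sub>R h d e) = ip d e *\<^sub>R h d e"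
      by (simp add: scaleR_sum_left)
  qed
  also have "\<dots> = (\<Sum>d\<in>E. \<Sum>e\<in>E. if d = e then h d e else 0)"
    by (intro sum.cong refl) (simp add: ip_E)
  also have "\<dots> = (\<Sum>e\<in>E. h e e)"
    using finite_E by simp
  finally show ?thesis .
qed

section \<open>The Levi-Civita connection and the Ricci operator\<close>

definition koszul :: "'v \<Rightarrow> 'v \<Rightarrow> 'v \<Rightarrow> real" where
  "koszul X Y Z = (ip (br X Y) Z + ip (br Z X) Y + ip X (br Z Y)) / 2"

text \<open>\<open>levi_civita\<close> is a definite description and is controlled only on
  \<open>V\<close>. This substitute is given by its coordinates, hence bilinear on the whole ambient
  space.\<close>

definition conn :: "'v \<Rightarrow> 'v \<Rightarrow> 'v" where
  "conn X Y = (\<Sum>e\<in>E. koszul X Y e *\<^sub>R e)"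

lemma bilinear_conn: "bilinear conn"
  unfolding bilinear_def conn_def koszul_def
  by (intro conjI allI linearI)
     (simp_all add: br_linear_simps ip_linear_simps add_divide_distrib scaleR_left_distrib
       sum.distrib scaleR_sum_right algebra_simps)

lemma linear_conn: "linear (conn x)" "linear (\<lambda>x. conn x y)"
  using bilinear_conn by (auto simp: bilinear_def)

lemma conn_in_V: "conn X Y \<in> V"
  unfolding conn_def using subspace_V E_in_V by (intro subspace_sum subspace_scale)

lemma ip_conn:
  assumes "Z \<in> V"
  shows "ip (conn X Y) Z = koszul X Y Z"
proof (rule linear_eq_on[of "ip (conn X Y)" "koszul X Y"])
  show "linear (ip (conn X Y))" by (rule linear_ip)
  show "linear (koszul X Y)" unfolding koszul_def
    by (intro linearI)
       (simp_all add: br_linear_simps ip_linear_simps add_divide_distrib algebra_simps)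
  show "Z \<in> span E" using assms span_E by simp
  show "ip (conn X Y) e = koszul X Y e" if "e \<in> E" for e
    using ip_expansion[OF that] unfolding conn_def by simp
qed

lemma levi_civita_eq:
  assumes "X \<in> V" "Y \<in> V"
  shows "levi_civita V br ip X Y = conn X Y"
  unfolding levi_civita_def
proof (rule the_equality)
  show "conn X Y \<in> V \<and>
      (\<forall>Z\<in>V. 2 * ip (conn X Y) Z = ip (br X Y) Z + ip (br Z X) Y + ip X (br Z Y))"
    by (simp add: conn_in_V ip_conn koszul_def)
  fix W assume W: "W \<in> V \<and>
      (\<forall>Z\<in>V. 2 * ip W Z = ip (br X Y) Z + ip (br Z X) Y + ip X (br Z Y))"
  then have "ip W e = koszul X Y e" if "e \<in> E" for e
    using E_in_V[OF that] unfolding koszul_def by (metis nonzero_mult_div_cancel_left zero_neq_numeral)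
  then show "W = conn X Y"
    using orthonormal_expansion[of W] W unfolding conn_def by (simp cong: sum.cong)
qed

lemma ricci_eq_trace:
  assumes X: "X \<in> V"
  shows "ricci V br ip X = (\<Sum>e\<in>E. conn X (conn e e) - conn e (conn X e) - conn (br X e) e)"
proof -
  define F where "F = (SOME E. orthonormal_basis_on V ip E)"
  have F: "orthonormal_basis_on V ip F"
    unfolding F_def using orthonormal by (rule someI)
  then have FV: "f \<in> V" if "f \<in> F" for f
    using that span_base unfolding orthonormal_basis_on_def by blast
  \<comment> \<open>For arguments in \<open>V\<close> this is the curvature, but written with
    \<open>conn\<close> it is bilinear everywhere, as \<open>trace_basis_independent\<close>
    requires.\<close>
  define h where "h Y Z = conn X (conn Y Z) - conn Y (conn X Z) - conn (br X Y) Z" for Y Z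
  note conn_simps = bilinear_ladd[OF bilinear_conn] bilinear_radd[OF bilinear_conn]
    bilinear_lmul[OF bilinear_conn] bilinear_rmul[OF bilinear_conn]
  have "bilinear h"
    unfolding bilinear_def h_def
    by (intro conjI allI linearI)
       (simp_all add: conn_simps br_linear_simps scaleR_diff_right)
  have "ricci V br ip X = (\<Sum>f\<in>F. h f f)"
    unfolding ricci_def F_def[symmetric] h_def riemann_curvature_def
    by (intro sum.cong) (simp_all add: levi_civita_eq X FV conn_in_V br_closed)
  also have "\<dots> = (\<Sum>e\<in>E. h e e)"
    by (rule trace_basis_independent) fact+
  finally show ?thesis unfolding h_def .
qed

text \<open>The classical Ricci form of a unimodular metric Lie algebra. For \<open>X\<close> and
  \<open>Y\<close> in \<open>V\<close> the last double sum is the trace of \<open>ad X\<close>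
  composed with \<open>ad Y\<close>, the Killing form.\<close>

definition ricci_form :: "'v \<Rightarrow> 'v \<Rightarrow> real" where
  "ricci_form X Y =
     (\<Sum>e\<in>E. \<Sum>e'\<in>E. ip (br e e') X * ip (br e e') Y) / 4
     - (\<Sum>e\<in>E. \<Sum>e'\<in>E. ip (br X e) e' * ip (br Y e) e') / 2
     - (\<Sum>e\<in>E. \<Sum>e'\<in>E. ip (br X e) e' * ip (br Y e') e) / 2"

lemma linear_ricci_form: "linear (\<lambda>X. ricci_form X Y)"
  unfolding ricci_form_def
  by (intro linearI)
     (simp_all add: br_linear_simps ip_linear_simps sum.distrib sum_distrib_left algebra_simps
       diff_divide_distrib add_divide_distrib)

text \<open>Unimodularity makes the sum of all \<open>conn e e\<close> vanish, and with it the first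
  curvature term. What remains is quadratic in the structure constants \<open>c\<close> and is
  compared with \<open>ricci_form\<close> using antisymmetry of \<open>c\<close> alone.\<close>

theorem ip_ricci:
  assumes unimodular: "\<And>e. e \<in> E \<Longrightarrow> (\<Sum>e'\<in>E. ip (br e e') e') = 0"
    and X: "X \<in> V" and Y: "Y \<in> V"
  shows "ip (ricci V br ip X) Y = ricci_form X Y"
proof -
  define c where "c A B C = ip (br A B) C" for A B C
  have c_antisym: "c A B C = - c B A C" for A B C
    unfolding c_def by (subst br_antisym) (simp add: bilinear_lneg[OF bilinear_ip])
  have koszul: "koszul A B C = (c A B C + c C A B + c C B A) / 2" for A B C
    unfolding koszul_def c_def by (simp add: ip_commute[of A])
  \<comment> \<open>The Koszul formula gives \<open>ip (conn e e) e' = c e' e e\<close>, so this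
    component is the trace of \<open>ad e'\<close>.\<close>
  have "ip (\<Sum>e\<in>E. conn e e) e' = 0" if "e' \<in> E" for e'
  proof -
    have "c e e e' = 0" for e using c_antisym[of e e e'] by simp
    then have "ip (\<Sum>e\<in>E. conn e e) e' = (\<Sum>e\<in>E. c e' e e)"
      using E_in_V[OF that] by (simp add: ip_sum_left ip_conn koszul)
    then show ?thesis using unimodular[OF that] unfolding c_def by simp
  qed
  moreover have "(\<Sum>e\<in>E. conn e e) \<in> V"
    by (intro subspace_sum[OF subspace_V] conn_in_V)
  ultimately have "(\<Sum>e\<in>E. conn e e) = 0"
    using orthonormal_expansion[of "\<Sum>e\<in>E. conn e e"] by simp
  then have "(\<Sum>e\<in>E. conn X (conn e e)) = 0"
    by (simp add: linear_sum[OF linear_conn(1), symmetric] linear_0[OF linear_conn(1)])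
  then have "ricci V br ip X = (\<Sum>e\<in>E. - conn e (conn X e) - conn (br X e) e)"
    using ricci_eq_trace[OF X] by (simp add: sum_subtractf sum_negf)
  then have "ip (ricci V br ip X) Y
      = (\<Sum>e\<in>E. - ip (conn e (conn X e)) Y - ip (conn (br X e) e) Y)"
    by (simp add: ip_sum_left bilinear_lsub[OF bilinear_ip] bilinear_lneg[OF bilinear_ip])
  also have "\<dots> = (\<Sum>e\<in>E. \<Sum>e'\<in>E. - koszul X e e' * koszul e e' Y - c X e e' * koszul e' e Y)"
  proof (rule sum.cong)
    fix e assume e: "e \<in> E"
    have "ip (conn e (conn X e)) Y = (\<Sum>e'\<in>E. koszul X e e' * koszul e e' Y)"
      unfolding conn_def[of X e]
      by (simp add: linear_sum[OF linear_conn(1)] linear_scale[OF linear_conn(1)]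
          ip_sum_left ip_linear_simps ip_conn[OF Y])
    moreover have "ip (conn (br X e) e) Y = (\<Sum>e'\<in>E. c X e e' * koszul e' e Y)"
      unfolding c_def
      by (subst orthonormal_expansion[OF br_closed[OF X E_in_V[OF e]]])
         (simp add: linear_sum[OF linear_conn(2)] linear_scale[OF linear_conn(2)]
          ip_sum_left ip_linear_simps ip_conn[OF Y])
    ultimately show "- ip (conn e (conn X e)) Y - ip (conn (br X e) e) Y
        = (\<Sum>e'\<in>E. - koszul X e e' * koszul e e' Y - c X e e' * koszul e' e Y)"
      by (simp add: sum_subtractf sum_negf)
  qed simp
  also have "\<dots> = (\<Sum>e\<in>E. \<Sum>e'\<in>E. c e e' X * c e e' Y / 4
      - c X e e' * c Y e e' / 2 - c X e e' * c Y e' e / 2)"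
  proof -
    \<comment> \<open>After symmetrizing in \<open>e\<close> and \<open>e'\<close> the two summands agree.\<close>
    have sym: "(\<Sum>e\<in>E. \<Sum>e'\<in>E. f e e') = (\<Sum>e\<in>E. \<Sum>e'\<in>E. (f e e' + f e' e) / 2)"
      for f :: "'v \<Rightarrow> 'v \<Rightarrow> real"
      using sum.swap[of f E E] by (simp add: sum.distrib sum_divide_distrib[symmetric])
    show ?thesis
    proof (subst (1 2) sym, intro sum.cong refl)
      fix e e'
      have "c e' X e = - c X e' e" "c e X e' = - c X e e'" "c e' e X = - c e e' X" for X
        by (rule c_antisym)+
      then show "(- koszul X e e' * koszul e e' Y - c X e e' * koszul e' e Y
            + (- koszul X e' e * koszul e' e Y - c X e' e * koszul e e' Y)) / 2
          = (c e e' X * c e e' Y / 4 - c X e e' * c Y e e' / 2 - c X e e' * c Y e' e / 2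
            + (c e' e X * c e' e Y / 4 - c X e' e * c Y e' e / 2 - c X e' e * c Y e e' / 2)) / 2"
        unfolding koszul by (simp add: field_simps)
    qed
  qed
  also have "\<dots> = ricci_form X Y"
    unfolding ricci_form_def c_def by (simp add: sum_subtractf sum_divide_distrib)
  finally show ?thesis .
qed

text \<open>Both sides are linear in \<open>X\<close>, so it suffices to compare them on
  \<open>E\<close>, where the coordinates of the left side are values of
  \<open>ricci_form\<close>.\<close>

corollary ricci_diagonal:
  assumes unimodular: "\<And>e. e \<in> E \<Longrightarrow> (\<Sum>e'\<in>E. ip (br e e') e') = 0"
    and diagonal: "\<And>e e'. e \<in> E \<Longrightarrow> e' \<in> E \<Longrightarrow>
      ricci_form e e' = (if e = e' then a e else 0)"
    and L: "linear L" "\<And>e. e \<in> E \<Longrightarrow> L e = a e *\<^sub>R e"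
    and X: "X \<in> V"
  shows "ricci V br ip X = L X"
proof -
  have "ricci V br ip X \<in> V"
    unfolding ricci_eq_trace[OF X]
    by (intro subspace_sum subspace_diff subspace_V conn_in_V)
  then have "ricci V br ip X = (\<Sum>e\<in>E. ricci_form X e *\<^sub>R e)"
    using orthonormal_expansion ip_ricci[OF unimodular X E_in_V] by (metis (no_types, lifting) sum.cong)
  also have "\<dots> = L X"
  proof (rule linear_eq_on[of "\<lambda>X. \<Sum>e\<in>E. ricci_form X e *\<^sub>R e" L])
    show "linear (\<lambda>X. \<Sum>e\<in>E. ricci_form X e *\<^sub>R e)"
      by (intro linearI)
         (simp_all add: linear_add[OF linear_ricci_form] linear_scale[OF linear_ricci_form] scaleR_left_distrib sum.distrib scaleR_sum_right)
    fix b assume b: "b \<in> E"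
    then have "(\<Sum>e\<in>E. ricci_form b e *\<^sub>R e) = (\<Sum>e\<in>E. if b = e then a b *\<^sub>R b else 0)"
      by (intro sum.cong) (simp_all add: diagonal)
    then show "(\<Sum>e\<in>E. ricci_form b e *\<^sub>R e) = L b" using b finite_E L(2) by simp
  qed (use X span_E L(1) in auto)
  finally show ?thesis .
qed

end

section \<open>The free vector space on pairs and its product\<close>

lemma orthonormal_imp_independent:
  assumes ip: "bilinear ip" and E: "finite E"
    and ip_E: "\<And>e e'. e \<in> E \<Longrightarrow> e' \<in> E \<Longrightarrow> ip e e' = (if e = e' then 1 else (0::real))"
  shows "independent E"
proof
  assume "dependent E"
  then obtain u v where v: "v \<in> E" "u v \<noteq> 0" and u: "(\<Sum>e\<in>E. u e *\<^sub>R e) = 0"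
    using dependent_finite[OF E] by auto
  have ip_v: "linear (\<lambda>x. ip x v)" using ip by (simp add: bilinear_def)
  have "(\<Sum>e\<in>E. u e * ip e v) = 0"
    using arg_cong[OF u, of "\<lambda>x. ip x v"]
    by (simp add: linear_sum[OF ip_v] linear_scale[OF ip_v] linear_0[OF ip_v])
  moreover have "(\<Sum>e\<in>E. u e * ip e v) = (\<Sum>e\<in>E. if e = v then u e else 0)"
    using v by (intro sum.cong) (simp_all add: ip_E)
  ultimately show False using v E by simp
qed

lemma bilinear_in_subspace:
  assumes h: "bilinear h" and W: "subspace W"
    and S: "\<And>a b. a \<in> S \<Longrightarrow> b \<in> T \<Longrightarrow> h a b \<in> W"
    and x: "x \<in> span S" and y: "y \<in> span T"
  shows "h x y \<in> W"
  using x
proof (induction rule: span_induct)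
  case base
  then show ?case
    using W linear_subspace_vimage[of "\<lambda>x. h x y" W] h by (simp add: bilinear_def vimage_def)
next
  case (step a)
  show ?case using y
  proof (induction rule: span_induct)
    case base
    then show ?case
      using W linear_subspace_vimage[of "h a" W] h by (simp add: bilinear_def vimage_def)
  qed (use S step in auto)
qed

text \<open>The linear map determined by its values \<open>g p\<close> on the basis vectors
  \<open>pair_vec p\<close>. The product, the weighted inner product, the action and the derivation
  are all built from it and inherit linearity.\<close>

definition linear_extension :: "('b \<Rightarrow> 'v::real_vector) \<Rightarrow> ('b \<Rightarrow>\<^sub>0 real) \<Rightarrow> 'v" where
  "linear_extension g x =
     (\<Sum>p\<in>Poly_Mapping.keys x. Poly_Mapping.lookup x p *\<^sub>R g p)"

lemma linear_extension_superset:
  assumes "finite A" "Poly_Mapping.keys x \<subseteq> A"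
  shows "linear_extension g x = (\<Sum>p\<in>A. Poly_Mapping.lookup x p *\<^sub>R g p)"
  unfolding linear_extension_def using assms
  by (intro sum.mono_neutral_left) (auto simp: in_keys_iff)

lemma linear_linear_extension:
  fixes g :: "'b \<Rightarrow> 'v::real_vector"
  shows "linear (linear_extension g)"
proof (rule linearI)
  fix x y :: "'b \<Rightarrow>\<^sub>0 real" and c :: real
  let ?A = "Poly_Mapping.keys x \<union> Poly_Mapping.keys y"
  have A: "finite ?A" by simp
  have "Poly_Mapping.keys (x + y) \<subseteq> ?A" by (rule Poly_Mapping.keys_add)
  then show "linear_extension g (x + y) = linear_extension g x + linear_extension g y"
    by (simp add: linear_extension_superset[OF A] lookup_add scaleR_left_distrib sum.distrib)
  have "Poly_Mapping.keys (c *\<^sub>R x) \<subseteq> ?A" by (auto simp: in_keys_iff)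
  then show "linear_extension g (c *\<^sub>R x) = c *\<^sub>R linear_extension g x"
    by (simp add: linear_extension_superset[OF A] scaleR_sum_right)
qed

lemma linear_extension_pair_vec [simp]: "linear_extension g (pair_vec p) = g p"
  by (simp add: linear_extension_def pair_vec_def)

lemma bilinear_linear_extension:
  "bilinear (\<lambda>x y. linear_extension (\<lambda>p. linear_extension (b p) y) x)"
proof -
  have "linear (\<lambda>y. linear_extension (\<lambda>p. linear_extension (b p) y) x)" for x
    unfolding linear_extension_def[of _ x]
    by (intro linearI)
       (simp_all add: linear_add[OF linear_linear_extension]
         linear_scale[OF linear_linear_extension] scaleR_add_right sum.distrib scaleR_sum_right
         mult.commute)
  then show ?thesis by (simp add: bilinear_def linear_linear_extension)
qed

text \<open>Every vector is the extension of \<open>pair_vec\<close> evaluated at itself. Identities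
  between total linear or bilinear maps thus need checking on pairs only.\<close>

lemma span_range_pair_vec: "span (range pair_vec) = UNIV"
proof -
  have eq: "linear_extension pair_vec x = x" for x :: "('a \<times> 'a) \<Rightarrow>\<^sub>0 real"
    unfolding linear_extension_def pair_vec_def
    by (rule poly_mapping_eqI)
       (auto simp: lookup_sum lookup_single when_def in_keys_iff if_distrib[of "(*) _"] cong: if_cong)
  have "linear_extension pair_vec x \<in> span (range pair_vec)"
    for x :: "('a \<times> 'a) \<Rightarrow>\<^sub>0 real"
    unfolding linear_extension_def by (intro span_sum span_scale span_base) simp
  then show ?thesis unfolding eq by blast
qed

lemma linear_eq_on_pair_vec:
  assumes "linear f" "linear g" "\<And>p. f (pair_vec p) = g (pair_vec p)"
  shows "f x = g x"
  using linear_eq_on[of f g x "range pair_vec", OF assms(1,2)] assms(3)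
  unfolding span_range_pair_vec by blast

lemma bilinear_eq_on_pair_vec:
  assumes "bilinear f" "bilinear g" "\<And>p q. f (pair_vec p) (pair_vec q) = g (pair_vec p) (pair_vec q)"
  shows "f x y = g x y"
  using bilinear_eq[of f g UNIV "range pair_vec" UNIV "range pair_vec" x y, OF assms(1,2)] assms(3)
  unfolding span_range_pair_vec by blast

section \<open>The associative product and its commutator bracket\<close>

lemma taos_mult_eq:
  "taos_mult x y = linear_extension (\<lambda>p. linear_extension (pair_mult p) y) x"
  unfolding taos_mult_def linear_extension_def by (simp add: scaleR_sum_right)

lemma bilinear_taos_mult: "bilinear taos_mult"
  unfolding taos_mult_eq[abs_def] by (rule bilinear_linear_extension)

lemma taos_mult_pair_vec: "taos_mult (pair_vec p) (pair_vec q) = pair_mult p q"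
  by (simp add: taos_mult_eq)

lemma linear_taos_mult: "linear (taos_mult x)" "linear (\<lambda>x. taos_mult x y)"
  using bilinear_taos_mult by (auto simp: bilinear_def)

text \<open>The vectors \<open>pair_vec (s, t)\<close> multiply like matrix units. Associativity
  passes from them to all vectors one argument at a time, starting with \<open>z\<close>.\<close>

lemma taos_mult_assoc: "taos_mult (taos_mult x y) z = taos_mult x (taos_mult y z)"
proof -
  \<comment> \<open>All compositions of left and right multiplications, to see that both sides are
    linear in the argument being extended.\<close>
  note compose = linear_compose[of "taos_mult _" "taos_mult _", unfolded o_def]
    linear_compose[of "taos_mult _" "\<lambda>x. taos_mult x _", unfolded o_def]
    linear_compose[of "\<lambda>x. taos_mult x _" "taos_mult _", unfolded o_def]
    linear_compose[of "\<lambda>x. taos_mult x _" "\<lambda>x. taos_mult x _", unfolded o_def]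
  have "pair_mult (fst p, snd q) t = pair_mult p (fst q, snd t)" if "snd p = fst q" "snd q = fst t"
    for p q t :: "'a \<times> 'a"
    using that by (simp add: pair_mult_def)
  then have 1: "taos_mult (taos_mult (pair_vec p) (pair_vec q)) (pair_vec t)
      = taos_mult (pair_vec p) (taos_mult (pair_vec q) (pair_vec t))" for p q t :: "'a \<times> 'a"
    by (auto simp: taos_mult_pair_vec pair_mult_def[of p q] pair_mult_def[of q t]
        linear_0[OF linear_taos_mult(1)] linear_0[OF linear_taos_mult(2)])
       (auto simp: pair_mult_def)
  have 2: "taos_mult (taos_mult (pair_vec p) (pair_vec q)) z
      = taos_mult (pair_vec p) (taos_mult (pair_vec q) z)" for p q
    by (rule linear_eq_on_pair_vec[of _ _ z]) (rule linear_taos_mult compose 1)+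
  have 3: "taos_mult (taos_mult (pair_vec p) y) z = taos_mult (pair_vec p) (taos_mult y z)" for p
    by (rule linear_eq_on_pair_vec[of _ _ y]) (rule linear_taos_mult compose 2)+
  show ?thesis
    by (rule linear_eq_on_pair_vec[of _ _ x]) (rule linear_taos_mult compose 3)+
qed

lemma bilinear_taos_bracket: "bilinear taos_bracket"
  using bilinear_taos_mult unfolding taos_bracket_def[abs_def] bilinear_def
  by (auto intro: linear_compose_sub)

lemma taos_bracket_antisym: "taos_bracket x y = - taos_bracket y x"
  by (simp add: taos_bracket_def)

lemma taos_bracket_pair_vec:
  "taos_bracket (pair_vec p) (pair_vec q) = pair_mult p q - pair_mult q p"
  by (simp add: taos_bracket_def taos_mult_pair_vec)

lemma taos_bracket_jacobi:
  "taos_bracket x (taos_bracket y z) + taos_bracket y (taos_bracket z x)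
     + taos_bracket z (taos_bracket x y) = 0"
  by (simp add: taos_bracket_def taos_mult_assoc bilinear_lsub[OF bilinear_taos_mult]
      bilinear_rsub[OF bilinear_taos_mult])

lemma taos_action_eq: "taos_action f = linear_extension (\<lambda>p. pair_vec (map_prod f f p))"
  unfolding taos_action_def linear_extension_def by (rule refl)

section \<open>Finite strict orders with weights\<close>

text \<open>The Ricci computation works for any weights that are positive on targets of pairs, so
  the weight stays a parameter until the section on arrays.\<close>

locale weighted_order =
  fixes P :: "'a set" and r :: "'a rel" and w :: "'a \<Rightarrow> real"
  assumes finite_r: "finite r" and r_subset: "r \<subseteq> P \<times> P"
    and trans_r: "trans r" and irrefl_r: "(s, s) \<notin> r"
    and w_pos: "(s, t) \<in> r \<Longrightarrow> w t > 0"
begin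

lemma rel_trans: "(s, t) \<in> r \<Longrightarrow> (t, v) \<in> r \<Longrightarrow> (s, v) \<in> r"
  using trans_r by (rule transD)

lemma rel_asym: "(s, t) \<in> r \<Longrightarrow> (t, s) \<notin> r"
  using rel_trans irrefl_r by blast

lemma taos_basis_eq: "taos_basis P r = r"
  unfolding taos_basis_def using r_subset irrefl_r by auto

section \<open>The weighted inner product and its orthonormal basis\<close>

definition weighted_ip :: "(('a \<times> 'a) \<Rightarrow>\<^sub>0 real) \<Rightarrow> (('a \<times> 'a) \<Rightarrow>\<^sub>0 real) \<Rightarrow> real" where
  "weighted_ip x y =
     linear_extension (\<lambda>p. linear_extension (\<lambda>q. if p = q then w (snd p) else 0) y) x"

lemma bilinear_weighted_ip: "bilinear weighted_ip"
  unfolding weighted_ip_def[abs_def] by (rule bilinear_linear_extension)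

lemma weighted_ip_pair_vec:
  "weighted_ip (pair_vec p) (pair_vec q) = (if p = q then w (snd p) else 0)"
  by (simp add: weighted_ip_def)

lemma weighted_ip_commute: "weighted_ip x y = weighted_ip y x"
  by (rule bilinear_eq_on_pair_vec[of weighted_ip "\<lambda>x y. weighted_ip y x"])
     (use bilinear_weighted_ip in \<open>auto simp: bilinear_def weighted_ip_pair_vec\<close>)

definition unit_vec :: "'a \<times> 'a \<Rightarrow> ('a \<times> 'a) \<Rightarrow>\<^sub>0 real" where
  "unit_vec p = (1 / sqrt (w (snd p))) *\<^sub>R pair_vec p"

lemma weighted_ip_unit_vec:
  "p \<in> r \<Longrightarrow> weighted_ip (unit_vec p) (unit_vec q) = (if p = q then 1 else 0)"
  using w_pos[of "fst p" "snd p"]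
  by (cases "p = q")
     (simp_all add: unit_vec_def bilinear_lmul[OF bilinear_weighted_ip]
      bilinear_rmul[OF bilinear_weighted_ip] weighted_ip_pair_vec)

lemma inj_unit_vec: "inj_on unit_vec r"
  using weighted_ip_unit_vec by (intro inj_onI) (metis zero_neq_one)

lemma span_unit_vec: "span (unit_vec ` r) = taos_space P r"
proof -
  have "span (unit_vec ` r) \<subseteq> span (pair_vec ` r)"
    by (rule span_minimal) (auto simp: unit_vec_def intro!: span_scale intro: span_base)
  moreover have "pair_vec p \<in> span (unit_vec ` r)" if "p \<in> r" for p
  proof -
    have "pair_vec p = sqrt (w (snd p)) *\<^sub>R unit_vec p"
      using w_pos[of "fst p" "snd p"] that by (simp add: unit_vec_def)
    then show ?thesis using that by (simp add: span_scale span_base)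
  qed
  then have "span (pair_vec ` r) \<subseteq> span (unit_vec ` r)"
    by (intro span_minimal) auto
  ultimately show ?thesis unfolding taos_space_def taos_basis_eq by blast
qed

lemma taos_bracket_closed:
  assumes "x \<in> taos_space P r" "y \<in> taos_space P r"
  shows "taos_bracket x y \<in> taos_space P r"
  using assms unfolding taos_space_def taos_basis_eq
proof (rule bilinear_in_subspace[OF bilinear_taos_bracket subspace_span, rotated])
  have "pair_mult p q \<in> span (pair_vec ` r)" if "p \<in> r" "q \<in> r" for p q
    using that rel_trans[of "fst p" "snd p" "snd q"]
    by (auto simp: pair_mult_def span_zero intro!: span_base)
  then show "taos_bracket a b \<in> span (pair_vec ` r)"
    if "a \<in> pair_vec ` r" "b \<in> pair_vec ` r" for a b
    using that by (elim imageE) (simp add: taos_bracket_pair_vec span_diff)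
qed

sublocale metric_algebra "taos_space P r" taos_bracket weighted_ip "unit_vec ` r"
proof
  show "orthonormal_basis_on (taos_space P r) weighted_ip (unit_vec ` r)"
    unfolding orthonormal_basis_on_def
  proof (intro conjI ballI)
    show ip: "weighted_ip e e' = (if e = e' then 1 else 0)"
      if "e \<in> unit_vec ` r" "e' \<in> unit_vec ` r" for e e'
    proof -
      obtain p q where "p \<in> r" "e = unit_vec p" "q \<in> r" "e' = unit_vec q"
        using \<open>e \<in> _\<close> \<open>e' \<in> _\<close> by (elim imageE)
      then show ?thesis
        using inj_unit_vec by (simp add: weighted_ip_unit_vec inj_on_eq_iff)
    qed
    show "independent (unit_vec ` r)"
      by (rule orthonormal_imp_independent[OF bilinear_weighted_ip finite_imageI[OF finite_r] ip])
  qed (use finite_r span_unit_vec in auto)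
qed (rule bilinear_taos_bracket bilinear_weighted_ip taos_bracket_antisym weighted_ip_commute
      | erule (1) taos_bracket_closed)+

theorem metric_lie_algebra: "metric_lie_algebra_on (taos_space P r) taos_bracket weighted_ip"
proof -
  have "taos_bracket x x = 0" for x :: "('a \<times> 'a) \<Rightarrow>\<^sub>0 real"
    by (simp add: taos_bracket_def)
  then have "lie_algebra_on (taos_space P r) taos_bracket"
    unfolding lie_algebra_on_def bilinear_map_on_def linear_map_on_def
    using subspace_V taos_bracket_closed taos_bracket_jacobi
    by (auto simp: br_linear_simps)
  moreover have "\<exists>E. finite E \<and> span E = taos_space P r"
    using finite_E span_E by blast
  ultimately show ?thesis
    unfolding metric_lie_algebra_on_def using inner_product by blast
qed

section \<open>Structure constants and the Ricci form in the unit basis\<close>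

definition composes :: "'a \<times> 'a \<Rightarrow> 'a \<times> 'a \<Rightarrow> 'a \<times> 'a \<Rightarrow> bool" where
  "composes p q u \<longleftrightarrow> snd p = fst q \<and> u = (fst p, snd q)"

definition struct_const :: "'a \<times> 'a \<Rightarrow> 'a \<times> 'a \<Rightarrow> 'a \<times> 'a \<Rightarrow> real" where
  "struct_const p q u = weighted_ip (taos_bracket (unit_vec p) (unit_vec q)) (unit_vec u)"

text \<open>Normalizing \<open>p\<close> and \<open>q\<close> contributes the two roots in the
  denominator. Pairing \<open>pair_vec u\<close> with its own unit vector contributes
  \<open>sqrt (w (snd u))\<close>.\<close>

lemma struct_const_eq:
  assumes "p \<in> r" "q \<in> r" "u \<in> r"
  shows "struct_const p q u = sqrt (w (snd u) / (w (snd p) * w (snd q)))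
           * (of_bool (composes p q u) - of_bool (composes q p u))"
proof -
  have "w (snd u) > 0" using w_pos[of "fst u" "snd u"] assms by simp
  then have "w (snd u) / (a * (b * sqrt (w (snd u)))) = sqrt (w (snd u)) / (a * b)" for a b
    using divide_divide_eq_left[of "w (snd u)" "sqrt (w (snd u))" "a * b"]
    by (simp add: real_div_sqrt mult_ac)
  moreover have "weighted_ip (pair_mult p q) (pair_vec u) = of_bool (composes p q u) * w (snd u)"
    for p q
    by (auto simp: pair_mult_def composes_def weighted_ip_pair_vec
        linear_0[OF linear_ip(2)])
  ultimately show ?thesis
    unfolding struct_const_def unit_vec_def
    by (simp add: br_linear_simps ip_linear_simps taos_bracket_pair_vec
        bilinear_lsub[OF bilinear_weighted_ip] real_sqrt_divide real_sqrt_mult field_simps)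
qed

lemma struct_const_eq_0:
  assumes "p \<in> r" "q \<in> r" "u \<in> r" "\<not> composes p q u" "\<not> composes q p u"
  shows "struct_const p q u = 0"
  using assms by (simp add: struct_const_eq)

lemma struct_const_square:
  assumes "p \<in> r" "q \<in> r" "u \<in> r"
  shows "struct_const p q u * struct_const p q u
    = (of_bool (composes p q u) + of_bool (composes q p u)) * (w (snd u) / (w (snd p) * w (snd q)))"
proof -
  \<comment> \<open>Both compositions at once would give a cycle; hence squaring the difference of
    indicators produces no cross term.\<close>
  have "\<not> (composes p q u \<and> composes q p u)"
    using assms rel_asym[of "fst p" "snd p"] by (auto simp: composes_def)
  moreover have "w (snd u) > 0" "w (snd p) > 0" "w (snd q) > 0"
    using assms w_pos[of "fst u"] w_pos[of "fst p"] w_pos[of "fst q"] by simp_all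
  then have "sqrt (w (snd u) / (w (snd p) * w (snd q))) * sqrt (w (snd u) / (w (snd p) * w (snd q)))
      = w (snd u) / (w (snd p) * w (snd q))"
    by (intro real_sqrt_mult_self[THEN trans] abs_of_pos) simp
  ultimately show ?thesis
    unfolding struct_const_eq[OF assms] by (auto simp del: real_sqrt_mult_self)
qed

text \<open>The Killing term vanishes summand by summand: if \<open>struct_const x i k\<close> is
  nonzero, then \<open>k\<close> extends \<open>i\<close> strictly at one end, whereas the other
  factor would make \<open>i\<close> a strict extension of \<open>k\<close>.\<close>

lemma ricci_form_unit_vec:
  assumes "x \<in> r" "y \<in> r"
  shows "ricci_form (unit_vec x) (unit_vec y) =
     (\<Sum>i\<in>r. \<Sum>k\<in>r. struct_const i k x * struct_const i k y) / 4
     - (\<Sum>i\<in>r. \<Sum>k\<in>r. struct_const x i k * struct_const y i k) / 2"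
proof -
  have "struct_const x i k * struct_const y k i = 0" if "i \<in> r" "k \<in> r" for i k
  proof -
    have "struct_const x i k = 0 \<or> struct_const y k i = 0"
    proof (rule ccontr)
      assume "\<not> ?thesis"
      then have "composes x i k \<or> composes i x k" "composes y k i \<or> composes k y i"
        using struct_const_eq_0 that assms by blast+
      then show False
        by (cases x; cases y; cases i; cases k)
           (use that assms irrefl_r in \<open>auto simp: composes_def dest: rel_asym\<close>)
    qed
    then show ?thesis by auto
  qed
  then have "(\<Sum>i\<in>r. \<Sum>k\<in>r. struct_const x i k * struct_const y k i) = 0"
    by (simp only: sum.neutral_const cong: sum.cong)
  then show ?thesis
    unfolding ricci_form_def sum.reindex[OF inj_unit_vec] o_def struct_const_def by simp
qed

text \<open>Bracketing with a basis vector strictly moves one endpoint of a pair, so every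
  \<open>ad e\<close> has zero diagonal.\<close>

lemma unimodular:
  "e \<in> unit_vec ` r \<Longrightarrow> (\<Sum>e'\<in>unit_vec ` r. weighted_ip (taos_bracket e e') e') = 0"
proof (clarify)
  fix a b assume ab: "(a, b) \<in> r"
  have "struct_const (a, b) q q = 0" if "q \<in> r" for q
    using that ab irrefl_r by (cases q, intro struct_const_eq_0) (auto simp: composes_def)
  then show "(\<Sum>e'\<in>unit_vec ` r. weighted_ip (taos_bracket (unit_vec (a, b)) e') e') = 0"
    unfolding sum.reindex[OF inj_unit_vec] o_def struct_const_def by simp
qed

text \<open>Any two of the three pairs in a nonzero structure constant determine the third, so no
  summand can be nonzero for distinct \<open>x\<close> and \<open>y\<close>.\<close>

lemma ricci_form_off_diagonal:
  assumes "x \<in> r" "y \<in> r" "x \<noteq> y"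
  shows "ricci_form (unit_vec x) (unit_vec y) = 0"
proof -
  have "struct_const i k x * struct_const i k y = 0" if "i \<in> r" "k \<in> r" for i k
  proof (rule ccontr)
    assume "\<not> ?thesis"
    then have "composes i k x \<or> composes k i x" "composes i k y \<or> composes k i y"
      using struct_const_eq_0[OF that(1,2)] assms by fastforce+
    then show False
      by (cases x; cases y; cases i; cases k)
         (use that assms in \<open>auto simp: composes_def dest: rel_asym\<close>)
  qed
  moreover have "struct_const x i k * struct_const y i k = 0" if "i \<in> r" "k \<in> r" for i k
  proof (rule ccontr)
    assume "\<not> ?thesis"
    then have "composes x i k \<or> composes i x k" "composes y i k \<or> composes i y k"
      using struct_const_eq_0[OF _ that] struct_const_eq_0[OF _ that(1) _] assms by fastforce+
    then show False
      by (cases x; cases y; cases i; cases k)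
         (use that assms irrefl_r in \<open>auto simp: composes_def dest: rel_asym\<close>)
  qed
  ultimately show ?thesis
    unfolding ricci_form_unit_vec[OF assms(1,2)]
    by (simp only: sum.neutral_const div_0 diff_0_right cong: sum.cong)
qed

text \<open>If \<open>fst p\<close> is minimal, \<open>w_pos\<close> says nothing about its weight,
  but the count divided by it is then 0.\<close>

definition ricci_eigenvalue :: "'a \<times> 'a \<Rightarrow> real" where
  "ricci_eigenvalue p =
     ((\<Sum>x | (fst p, x) \<in> r \<and> (x, snd p) \<in> r. 1 / w x)
      - real (card {x. (snd p, x) \<in> r}) / w (snd p)
      - real (card {x. (x, fst p) \<in> r}) / w (fst p)) / 2"

text \<open>Factorizations of \<open>x\<close> into two pairs correspond to the elements strictly
  between its endpoints.\<close>

lemma sum_composes_left: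
  assumes "x \<in> r"
  shows "(\<Sum>i\<in>r. \<Sum>k\<in>r. of_bool (composes i k x) * g i)
    = (\<Sum>z | (fst x, z) \<in> r \<and> (z, snd x) \<in> r. g (fst x, z) :: real)"
proof -
  let ?I = "{z. (fst x, z) \<in> r \<and> (z, snd x) \<in> r}"
  let ?J = "(\<lambda>z. ((fst x, z), (z, snd x))) ` ?I"
  have "(\<Sum>i\<in>r. \<Sum>k\<in>r. of_bool (composes i k x) * g i)
      = (\<Sum>(i, k)\<in>r \<times> r. of_bool (composes i k x) * g i)"
    by (rule sum.cartesian_product)
  also have "\<dots> = (\<Sum>(i, k)\<in>?J. of_bool (composes i k x) * g i)"
  proof (rule sum.mono_neutral_right)
    show "\<forall>q\<in>r \<times> r - ?J. (case q of (i, k) \<Rightarrow> of_bool (composes i k x) * g i) = 0"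
      by (auto simp: composes_def image_iff)
  qed (use finite_r in auto)
  also have "\<dots> = (\<Sum>z\<in>?I. g (fst x, z))"
    by (subst sum.reindex) (auto simp: inj_on_def composes_def)
  finally show ?thesis .
qed

text \<open>Each pair \<open>i\<close> starting at \<open>snd x\<close> admits exactly one
  \<open>k\<close>, with the same target as \<open>i\<close>. Since weights see only targets,
  \<open>w (snd k)\<close> cancels \<open>w (snd i)\<close>.\<close>

lemma sum_composes_right:
  assumes "x \<in> r"
  shows "(\<Sum>i\<in>r. \<Sum>k\<in>r. of_bool (composes x i k) * (w (snd k) / (w (snd x) * w (snd i))))
    = real (card {v. (snd x, v) \<in> r}) / w (snd x)"
proof -
  have "(\<Sum>k\<in>r. of_bool (composes x i k) * (w (snd k) / (w (snd x) * w (snd i))))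
      = (if fst i = snd x then 1 / w (snd x) else 0)" if i: "i \<in> r" for i
  proof -
    have "(\<Sum>k\<in>r. of_bool (composes x i k) * (w (snd k) / (w (snd x) * w (snd i))))
        = (\<Sum>k\<in>r. if k = (fst x, snd i) then of_bool (fst i = snd x) / w (snd x) else 0)"
      using w_pos[of "fst i" "snd i"] i by (intro sum.cong) (auto simp: composes_def)
    then show ?thesis
      using finite_r i assms rel_trans[of "fst x" "snd x" "snd i"] by (cases i) auto
  qed
  then have "(\<Sum>i\<in>r. \<Sum>k\<in>r. of_bool (composes x i k) * (w (snd k) / (w (snd x) * w (snd i))))
      = (\<Sum>i\<in>r. if fst i = snd x then 1 / w (snd x) else 0)"
    by simp
  also have "\<dots> = (\<Sum>i | i \<in> r \<and> fst i = snd x. 1 / w (snd x))"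
    by (rule sum.inter_filter[OF finite_r, symmetric])
  also have "card {i. i \<in> r \<and> fst i = snd x} = card {v. (snd x, v) \<in> r}"
    by (rule bij_betw_same_card[of snd]) (auto simp: bij_betw_def inj_on_def image_iff)
  then have "(\<Sum>i | i \<in> r \<and> fst i = snd x. 1 / w (snd x))
      = real (card {v. (snd x, v) \<in> r}) / w (snd x)" by simp
  finally show ?thesis .
qed

text \<open>Here \<open>k\<close> has the target of \<open>x\<close>, so the weight of
  \<open>snd x\<close> cancels and the weight of \<open>snd i = fst x\<close> survives.\<close>

lemma sum_composes_middle:
  assumes "x \<in> r"
  shows "(\<Sum>i\<in>r. \<Sum>k\<in>r. of_bool (composes i x k) * (w (snd k) / (w (snd x) * w (snd i))))
    = real (card {u. (u, fst x) \<in> r}) / w (fst x)"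
proof -
  have "(\<Sum>k\<in>r. of_bool (composes i x k) * (w (snd k) / (w (snd x) * w (snd i))))
      = (if snd i = fst x then 1 / w (fst x) else 0)" if i: "i \<in> r" for i
  proof -
    have "(\<Sum>k\<in>r. of_bool (composes i x k) * (w (snd k) / (w (snd x) * w (snd i))))
        = (\<Sum>k\<in>r. if k = (fst i, snd x) then of_bool (snd i = fst x) / w (fst x) else 0)"
      using w_pos[of "fst x" "snd x"] assms by (intro sum.cong) (auto simp: composes_def)
    then show ?thesis
      using finite_r i assms rel_trans[of "fst i" "snd i" "snd x"] by (cases x) auto
  qed
  then have "(\<Sum>i\<in>r. \<Sum>k\<in>r. of_bool (composes i x k) * (w (snd k) / (w (snd x) * w (snd i))))
      = (\<Sum>i\<in>r. if snd i = fst x then 1 / w (fst x) else 0)"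
    by simp
  also have "\<dots> = (\<Sum>i | i \<in> r \<and> snd i = fst x. 1 / w (fst x))"
    by (rule sum.inter_filter[OF finite_r, symmetric])
  also have "card {i. i \<in> r \<and> snd i = fst x} = card {u. (u, fst x) \<in> r}"
    by (rule bij_betw_same_card[of fst]) (auto simp: bij_betw_def inj_on_def image_iff)
  then have "(\<Sum>i | i \<in> r \<and> snd i = fst x. 1 / w (fst x))
      = real (card {u. (u, fst x) \<in> r}) / w (fst x)" by simp
  finally show ?thesis .
qed

text \<open>Each factorization of \<open>x\<close> is counted in both orders, which turns the
  coefficient 1/4 into 1/2. The other double sum splits into the extensions of \<open>x\<close>
  beyond its target and below its source.\<close>

lemma ricci_form_diagonal:
  assumes x: "x \<in> r"
  shows "ricci_form (unit_vec x) (unit_vec x) = ricci_eigenvalue x"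
proof -
  let ?S = "\<Sum>i\<in>r. \<Sum>k\<in>r. of_bool (composes i k x) * (1 / w (snd i))"
  have "struct_const i k x * struct_const i k x
      = of_bool (composes i k x) * (1 / w (snd i)) + of_bool (composes k i x) * (1 / w (snd k))"
    if "i \<in> r" "k \<in> r" for i k
    using that w_pos[of "fst x" "snd x"] x
    by (auto simp: struct_const_square composes_def of_bool_def)
  then have "(\<Sum>i\<in>r. \<Sum>k\<in>r. struct_const i k x * struct_const i k x)
      = ?S + (\<Sum>i\<in>r. \<Sum>k\<in>r. of_bool (composes k i x) * (1 / w (snd k)))"
    by (simp add: sum.distrib)
  also have "(\<Sum>i\<in>r. \<Sum>k\<in>r. of_bool (composes k i x) * (1 / w (snd k))) = ?S"
    by (rule sum.swap)
  also have "?S = (\<Sum>z | (fst x, z) \<in> r \<and> (z, snd x) \<in> r. 1 / w z)"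
    by (subst sum_composes_left[OF x]) simp
  finally have 1: "(\<Sum>i\<in>r. \<Sum>k\<in>r. struct_const i k x * struct_const i k x)
      = 2 * (\<Sum>z | (fst x, z) \<in> r \<and> (z, snd x) \<in> r. 1 / w z)" by simp
  have 2: "(\<Sum>i\<in>r. \<Sum>k\<in>r. struct_const x i k * struct_const x i k)
      = real (card {v. (snd x, v) \<in> r}) / w (snd x) + real (card {u. (u, fst x) \<in> r}) / w (fst x)"
    using x by (simp only: struct_const_square distrib_right sum.distrib
        sum_composes_right sum_composes_middle cong: sum.cong)
  show ?thesis
    unfolding ricci_form_unit_vec[OF x x] 1 2 ricci_eigenvalue_def by (simp add: field_simps)
qed

section \<open>The operator Ric + id, and invariance of the inner product\<close>

definition soliton_derivation :: "(('a \<times> 'a) \<Rightarrow>\<^sub>0 real) \<Rightarrow> (('a \<times> 'a) \<Rightarrow>\<^sub>0 real)" where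
  "soliton_derivation = linear_extension (\<lambda>p. (1 + ricci_eigenvalue p) *\<^sub>R pair_vec p)"

lemma linear_soliton_derivation: "linear soliton_derivation"
  unfolding soliton_derivation_def by (rule linear_linear_extension)

lemma soliton_derivation_pair_vec:
  "soliton_derivation (pair_vec p) = (1 + ricci_eigenvalue p) *\<^sub>R pair_vec p"
  by (simp add: soliton_derivation_def)

theorem ricci_eq:
  assumes "X \<in> taos_space P r"
  shows "ricci (taos_space P r) taos_bracket weighted_ip X = - X + soliton_derivation X"
proof (rule ricci_diagonal[OF unimodular _ _ _ assms,
    \<comment> \<open>\<open>ricci_diagonal\<close> indexes eigenvalues by basis vectors;
      injectivity of \<open>unit_vec\<close> on \<open>r\<close> recovers the pair.\<close>
    where a = "\<lambda>e. ricci_eigenvalue (inv_into r unit_vec e)"])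
  show "ricci_form e e' = (if e = e' then ricci_eigenvalue (inv_into r unit_vec e) else 0)"
    if "e \<in> unit_vec ` r" "e' \<in> unit_vec ` r" for e e'
  proof -
    obtain p q where pq: "p \<in> r" "e = unit_vec p" "q \<in> r" "e' = unit_vec q"
      using \<open>e \<in> _\<close> \<open>e' \<in> _\<close> by (elim imageE)
    then show ?thesis
      using inj_unit_vec
      by (cases "p = q")
         (simp_all add: inj_on_eq_iff ricci_form_diagonal ricci_form_off_diagonal)
  qed
  show "linear (\<lambda>X. - X + soliton_derivation X)"
    by (intro linearI) (simp_all add: linear_add[OF linear_soliton_derivation]
        linear_scale[OF linear_soliton_derivation] algebra_simps)
  show "- e + soliton_derivation e = ricci_eigenvalue (inv_into r unit_vec e) *\<^sub>R e"
    if "e \<in> unit_vec ` r" for e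
  proof -
    obtain p where p: "p \<in> r" "e = unit_vec p" using \<open>e \<in> _\<close> by (elim imageE)
    have "- unit_vec p + soliton_derivation (unit_vec p) = ricci_eigenvalue p *\<^sub>R unit_vec p"
      by (simp add: unit_vec_def soliton_derivation_pair_vec
          linear_scale[OF linear_soliton_derivation] scaleR_left_distrib scaleR_right_distrib)
    then show ?thesis using p inj_unit_vec by simp
  qed
qed

text \<open>A diagonal operator is a derivation once its eigenvalues add up along compositions. For
  the eigenvalues \<open>1 + ricci_eigenvalue p\<close> this additivity is exactly
  \<open>balanced\<close>.\<close>

lemma soliton_derivation_in_derivations:
  assumes balanced: "\<And>s t v. (s, t) \<in> r \<Longrightarrow> (t, v) \<in> r \<Longrightarrow>
      ricci_eigenvalue (s, v) = ricci_eigenvalue (s, t) + ricci_eigenvalue (t, v) + 1"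
  shows "soliton_derivation \<in> derivations_on (taos_space P r) taos_bracket"
proof -
  let ?D = soliton_derivation and ?V = "taos_space P r"
  have "?D (pair_vec p) \<in> span (pair_vec ` r)" if "p \<in> r" for p
    using that by (simp add: soliton_derivation_pair_vec span_scale span_base)
  then have "?V \<subseteq> ?D -` ?V"
    unfolding taos_space_def taos_basis_eq
    by (intro span_minimal linear_subspace_vimage linear_soliton_derivation subspace_span) auto
  moreover have "?D (taos_bracket x y) = taos_bracket (?D x) y + taos_bracket x (?D y)"
    if "x \<in> ?V" "y \<in> ?V" for x y
  proof (rule bilinear_eq[of "\<lambda>x y. ?D (taos_bracket x y)"
        "\<lambda>x y. taos_bracket (?D x) y + taos_bracket x (?D y)" ?V "pair_vec ` r" ?V "pair_vec ` r"])
    note D_simps = linear_add[OF linear_soliton_derivation] linear_scale[OF linear_soliton_derivation]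
    show "bilinear (\<lambda>x y. ?D (taos_bracket x y))"
      "bilinear (\<lambda>x y. taos_bracket (?D x) y + taos_bracket x (?D y))"
      unfolding bilinear_def
      by (intro conjI allI linearI; simp add: D_simps br_linear_simps scaleR_add_right)+
    have D_mult: "?D (pair_mult p q) = (2 + ricci_eigenvalue p + ricci_eigenvalue q) *\<^sub>R pair_mult p q"
      if "p \<in> r" "q \<in> r" for p q
      using that balanced[of "fst p" "snd p" "snd q"]
      by (auto simp: pair_mult_def soliton_derivation_pair_vec linear_0[OF linear_soliton_derivation])
    show "?D (taos_bracket a b) = taos_bracket (?D a) b + taos_bracket a (?D b)"
      if "a \<in> pair_vec ` r" "b \<in> pair_vec ` r" for a b
      using that
      by (auto simp: soliton_derivation_pair_vec br_linear_simps taos_bracket_pair_vec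
          linear_diff[OF linear_soliton_derivation] D_mult algebra_simps scaleR_2)
  qed (use that in \<open>auto simp: taos_space_def taos_basis_eq\<close>)
  ultimately show ?thesis
    unfolding derivations_on_def linear_map_on_def
    by (auto simp: linear_add[OF linear_soliton_derivation] linear_scale[OF linear_soliton_derivation])
qed

lemma weighted_ip_action:
  assumes f: "inj_on f P" and w_f: "\<And>t. t \<in> P \<Longrightarrow> w (f t) = w t"
    and "x \<in> taos_space P r" "y \<in> taos_space P r"
  shows "weighted_ip (taos_action f x) (taos_action f y) = weighted_ip x y"
proof (rule bilinear_eq[of "\<lambda>x y. weighted_ip (taos_action f x) (taos_action f y)" weighted_ip
      "taos_space P r" "pair_vec ` r" "taos_space P r" "pair_vec ` r"])
  have "linear (taos_action f)" unfolding taos_action_eq by (rule linear_linear_extension)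
  then show "bilinear (\<lambda>x y. weighted_ip (taos_action f x) (taos_action f y))"
    using linear_ip linear_compose[unfolded o_def] unfolding bilinear_def by blast
  have "map_prod f f p = map_prod f f q \<longleftrightarrow> p = q" if "p \<in> r" "q \<in> r" for p q
    using that r_subset f by (auto simp: map_prod_def inj_on_def split: prod.splits)
  moreover have "w (f (snd p)) = w (snd p)" if "p \<in> r" for p
    using that r_subset w_f by auto
  ultimately show "weighted_ip (taos_action f a) (taos_action f b) = weighted_ip a b"
    if "a \<in> pair_vec ` r" "b \<in> pair_vec ` r" for a b
    using that by (auto simp: taos_action_eq weighted_ip_pair_vec)
qed (use assms bilinear_weighted_ip in \<open>auto simp: taos_space_def taos_basis_eq\<close>)

end

section \<open>Array TAOS\<close>

text \<open>Phrased through \<open>r\<close> alone rather than through columns, so that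
  automorphisms visibly preserve it.\<close>

definition twins :: "'a set \<Rightarrow> 'a rel \<Rightarrow> 'a \<Rightarrow> 'a set" where
  "twins P r t = {x \<in> P. r `` {x} = r `` {t} \<and> r\<inverse> `` {x} = r\<inverse> `` {t}}"

text \<open>The factor 1/2 is the normalization that makes the soliton constant -1.\<close>

definition soliton_weight :: "'a set \<Rightarrow> 'a rel \<Rightarrow> 'a \<Rightarrow> real" where
  "soliton_weight P r t =
     real (card (r `` {t}) + card (r\<inverse> `` {t}) + card (twins P r t)) / 2"

lemma soliton_weight_pos:
  assumes "finite P" "t \<in> P"
  shows "soliton_weight P r t > 0"
proof -
  have "t \<in> twins P r t" "finite (twins P r t)"
    using assms by (auto simp: twins_def)
  then have "card (twins P r t) > 0" by (auto simp: card_gt_0_iff)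
  then show ?thesis by (simp add: soliton_weight_def)
qed

lemma soliton_weight_twins:
  "x \<in> twins P r t \<Longrightarrow> soliton_weight P r x = soliton_weight P r t"
  by (simp add: soliton_weight_def twins_def)

text \<open>The terms at the outer ends \<open>s\<close> and \<open>v\<close> cancel. The elements
  between \<open>s\<close> and \<open>v\<close> split into those below \<open>t\<close>, those above
  \<open>t\<close> and the twins of \<open>t\<close>, and all twins have weight
  \<open>soliton_weight P r t\<close>. The excess is half of (above + below + twins) divided by that
  weight, which is 1.\<close>

lemma ricci_eigenvalue_balanced:
  assumes "weighted_order P r (soliton_weight P r)" and P: "finite P"
    and comparable: "\<And>x. (s, x) \<in> r \<Longrightarrow> (x, v) \<in> r \<Longrightarrow> (x, t) \<in> r \<or> (t, x) \<in> r \<or> x \<in> twins P r t"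
    and st: "(s, t) \<in> r" and tv: "(t, v) \<in> r"
  shows "weighted_order.ricci_eigenvalue r (soliton_weight P r) (s, v)
    = weighted_order.ricci_eigenvalue r (soliton_weight P r) (s, t)
      + weighted_order.ricci_eigenvalue r (soliton_weight P r) (t, v) + 1"
proof -
  interpret weighted_order P r "soliton_weight P r" by fact
  let ?w = "soliton_weight P r"
  let ?I = "\<lambda>a b. {x. (a, x) \<in> r \<and> (x, b) \<in> r}"
  have fin: "finite (?I a b)" for a b
    by (rule finite_subset[OF _ finite_imageI[OF finite_r, of snd]]) force
  have twins: "x \<in> twins P r t \<longleftrightarrow>
      x \<in> P \<and> (\<forall>y. (x, y) \<in> r \<longleftrightarrow> (t, y) \<in> r) \<and> (\<forall>y. (y, x) \<in> r \<longleftrightarrow> (y, t) \<in> r)"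
    for x by (auto simp: twins_def)
  have "?I s v = ?I s t \<union> ?I t v \<union> twins P r t"
  proof (intro equalityI subsetI)
    fix x assume "x \<in> ?I s v"
    then show "x \<in> ?I s t \<union> ?I t v \<union> twins P r t" using comparable[of x] by blast
  next
    fix x assume "x \<in> ?I s t \<union> ?I t v \<union> twins P r t"
    then show "x \<in> ?I s v" using st tv rel_trans twins[of x] by blast
  qed
  moreover have "?I s t \<inter> ?I t v = {}"
    using rel_asym by blast
  moreover have "(?I s t \<union> ?I t v) \<inter> twins P r t = {}"
    using irrefl_r[of t] twins by blast
  moreover have "finite (twins P r t)" using P by (simp add: twins_def)
  ultimately have "(\<Sum>x\<in>?I s v. 1 / ?w x)
      = (\<Sum>x\<in>?I s t. 1 / ?w x) + (\<Sum>x\<in>?I t v. 1 / ?w x) + (\<Sum>x\<in>twins P r t. 1 / ?w x)"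
    using fin by (simp add: sum.union_disjoint)
  also have "(\<Sum>x\<in>twins P r t. 1 / ?w x) = real (card (twins P r t)) / ?w t"
    by (simp add: soliton_weight_twins cong: sum.cong)
  finally have sum: "(\<Sum>x\<in>?I s v. 1 / ?w x) = (\<Sum>x\<in>?I s t. 1 / ?w x) + (\<Sum>x\<in>?I t v. 1 / ?w x)
      + real (card (twins P r t)) / ?w t" .
  have "?w t > 0" using w_pos[OF st] .
  moreover have "real (card {x. (t, x) \<in> r}) + real (card {x. (x, t) \<in> r})
      + real (card (twins P r t)) = 2 * ?w t"
    by (simp add: soliton_weight_def Image_def)
  ultimately have "real (card {x. (t, x) \<in> r}) / ?w t + real (card {x. (x, t) \<in> r}) / ?w t
      + real (card (twins P r t)) / ?w t = 2"
    by (simp add: add_divide_distrib[symmetric])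
  then show ?thesis unfolding ricci_eigenvalue_def fst_conv snd_conv sum by (simp add: field_simps)
qed

text \<open>Since \<open>f\<close> and its inverse preserve \<open>r\<close>, \<open>f\<close> maps
  the upper set, the lower set and the twins of \<open>t\<close> bijectively onto those of
  \<open>f t\<close>.\<close>

lemma soliton_weight_aut:
  assumes r: "r \<subseteq> P \<times> P" and f: "f \<in> taos_aut P r" and t: "t \<in> P"
  shows "soliton_weight P r (f t) = soliton_weight P r t"
proof -
  have inj: "inj_on f P" and image: "f ` P = P"
    using f by (auto simp: taos_aut_def bij_betw_def)
  have f_P: "f x \<in> P" if "x \<in> P" for x using image that by blast
  have iff: "(f x, f y) \<in> r \<longleftrightarrow> (x, y) \<in> r" if "x \<in> P" "y \<in> P" for x y
  proof
    assume "(f x, f y) \<in> r"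
    then have "(inv_into P f (f x), inv_into P f (f y)) \<in> r"
      using f f_P[OF that(1)] f_P[OF that(2)] unfolding taos_aut_def order_preserving_on_def by simp
    then show "(x, y) \<in> r" using that inj by simp
  qed (use f that in \<open>auto simp: taos_aut_def order_preserving_on_def\<close>)
  have above: "r `` {f x} = f ` (r `` {x})" and below: "r\<inverse> `` {f x} = f ` (r\<inverse> `` {x})"
    if "x \<in> P" for x
  proof -
    show "r `` {f x} = f ` (r `` {x})"
    proof (intro equalityI subsetI)
      fix y assume y: "y \<in> r `` {f x}"
      then have "y \<in> f ` P" using r image by auto
      then show "y \<in> f ` (r `` {x})" using y iff[OF that] by auto
    next
      fix y assume "y \<in> f ` (r `` {x})"
      then obtain z where "(x, z) \<in> r" "y = f z" by auto
      then show "y \<in> r `` {f x}" using r iff[OF that, of z] by auto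
    qed
    show "r\<inverse> `` {f x} = f ` (r\<inverse> `` {x})"
    proof (intro equalityI subsetI)
      fix y assume y: "y \<in> r\<inverse> `` {f x}"
      then have "y \<in> f ` P" using r image by auto
      then show "y \<in> f ` (r\<inverse> `` {x})" using y iff[OF _ that] by auto
    next
      fix y assume "y \<in> f ` (r\<inverse> `` {x})"
      then obtain z where "(z, x) \<in> r" "y = f z" by auto
      then show "y \<in> r\<inverse> `` {f x}" using r iff[OF _ that, of z] by auto
    qed
  qed
  have sub: "r `` {x} \<subseteq> P" "r\<inverse> `` {x} \<subseteq> P" for x using r by auto
  have "f x \<in> twins P r (f t) \<longleftrightarrow> x \<in> twins P r t" if "x \<in> P" for x
    using that f_P[OF that] unfolding twins_def
    by (simp add: above[OF that] above[OF t] below[OF that] below[OF t]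
        inj_on_image_eq_iff[OF inj sub(1) sub(1)] inj_on_image_eq_iff[OF inj sub(2) sub(2)]
        del: Image_singleton_iff Image_singleton)
  moreover have "twins P r y \<subseteq> P" for y by (auto simp: twins_def)
  ultimately have "twins P r (f t) = f ` twins P r t"
    using image by (auto simp: set_eq_iff image_iff) (metis subsetD)+
  moreover have "twins P r t \<subseteq> P" by (auto simp: twins_def)
  moreover have "card (f ` A) = card A" if "A \<subseteq> P" for A
    using card_image inj_on_subset[OF inj that] by blast
  ultimately show ?thesis
    unfolding soliton_weight_def above[OF t] below[OF t] using sub by simp
qed

text \<open>Computes the transitive closure: \<open>x\<close> precedes \<open>y\<close> exactly when
  \<open>y\<close> is a chosen element of a later column. Chains across several columns exist
  because every \<open>M j\<close> with \<open>1 < j\<close> and \<open>j \<le> k\<close> is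
  nonempty.\<close>

lemma array_taos_columns:
  assumes "array_taos k n m P r"
  obtains C M where "P = (\<Union>i\<in>{1..k}. C i)"
    and "disjoint_family_on C {1..k}" and "\<forall>j. 1 < j \<longrightarrow> j \<le> k \<longrightarrow> M j \<subseteq> C j"
    and "r = {(x, y). \<exists>i j. 1 \<le> i \<and> i < j \<and> j \<le> k \<and> x \<in> C i \<and> y \<in> M j}"
proof -
  obtain C M where P: "P = (\<Union>i\<in>{1..k}. C i)" and disj: "disjoint_family_on C {1..k}"
    and m: "\<forall>i\<in>{1..k}. 1 \<le> m i"
    and M: "\<forall>i\<in>{1..<k}. M (i + 1) \<subseteq> C (i + 1) \<and> card (M (i + 1)) = m (i + 1)"
    and r: "r = (\<Union>i\<in>{1..<k}. C i \<times> M (i + 1))\<^sup>+"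
    using assms unfolding array_taos_def by blast
  have column: "i = j" if "i \<in> {1..k}" "j \<in> {1..k}" "x \<in> C i" "x \<in> C j" for i j x
    using disj that unfolding disjoint_family_on_def by blast
  have M': "M j \<subseteq> C j \<and> card (M j) = m j" if "1 < j" "j \<le> k" for j
  proof -
    have "j - 1 \<in> {1..<k}" "j - 1 + 1 = j" using that by auto
    then show ?thesis using M by metis
  qed
  then have subset: "M j \<subseteq> C j" if "1 < j" "j \<le> k" for j
    using that by blast
  have nonempty: "M j \<noteq> {}" if "1 < j" "j \<le> k" for j
    using M'[OF that] bspec[OF m, of j] that by auto
  have "\<exists>i j. 1 \<le> i \<and> i < j \<and> j \<le> k \<and> x \<in> C i \<and> y \<in> M j" if "(x, y) \<in> r" for x y
    using that unfolding r
  proof (induction rule: trancl_induct)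
    case (base y)
    then obtain i where "i \<in> {1..<k}" "x \<in> C i" "y \<in> M (i + 1)" by blast
    then show ?case by (intro exI[of _ i] exI[of _ "i + 1"]) auto
  next
    case (step y z)
    then obtain i j l where "1 \<le> i" "i < j" "j \<le> k" "x \<in> C i" "y \<in> M j"
      "l \<in> {1..<k}" "y \<in> C l" "z \<in> M (l + 1)" by blast
    \<comment> \<open>The middle element \<open>y\<close> lies in columns \<open>j\<close> and
      \<open>l\<close>; disjointness identifies them.\<close>
    moreover from this have "j = l" using subset[of j] by (intro column[of j l y]) auto
    ultimately show ?case by (intro exI[of _ i] exI[of _ "l + 1"]) auto
  qed
  moreover have "(x, y) \<in> r" if "1 \<le> i" "i < j" "j \<le> k" "x \<in> C i" "y \<in> M j" for i j x y
  proof -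
    have "Suc i \<le> j" using that by simp
    then show ?thesis
      using that(3,5)
    proof (induction j arbitrary: y rule: dec_induct)
      case base
      then have "(x, y) \<in> (\<Union>i\<in>{1..<k}. C i \<times> M (i + 1))" using that(1,4) by auto
      then show ?case unfolding r by (rule r_into_trancl)
    next
      case (step j)
      then have "1 < j" "j \<le> k" using that(1) by auto
      \<comment> \<open>Any chosen element of column \<open>j\<close> serves as the last stop before
        column \<open>j + 1\<close>.\<close>
      then obtain z where z: "z \<in> M j" "z \<in> C j" using nonempty subset by blast
      then have "(x, z) \<in> r" using step.IH \<open>j \<le> k\<close> by blast
      moreover have "(z, y) \<in> (\<Union>i\<in>{1..<k}. C i \<times> M (i + 1))"
        using z step.prems \<open>1 < j\<close> by (intro UN_I[of j]) auto
      ultimately show ?case unfolding r by (rule trancl_into_trancl)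
    qed
  qed
  ultimately have "r = {(x, y). \<exists>i j. 1 \<le> i \<and> i < j \<and> j \<le> k \<and> x \<in> C i \<and> y \<in> M j}"
    by blast
  then show thesis using that[OF P disj] subset by blast
qed

lemma array_taos_irrefl:
  assumes "array_taos k n m P r"
  shows "(x, x) \<notin> r"
proof
  assume x: "(x, x) \<in> r"
  obtain C M where disj: "disjoint_family_on C {1..k}"
    and "\<forall>j. 1 < j \<longrightarrow> j \<le> k \<longrightarrow> M j \<subseteq> C j"
    and "r = {(x, y). \<exists>i j. 1 \<le> i \<and> i < j \<and> j \<le> k \<and> x \<in> C i \<and> y \<in> M j}"
    by (rule array_taos_columns[OF assms])
  then have M: "M j \<subseteq> C j" if "1 < j" "j \<le> k" for j using that by blast
  have column: "i = j" if "i \<in> {1..k}" "j \<in> {1..k}" "x \<in> C i" "x \<in> C j" for i j x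
    using disj that unfolding disjoint_family_on_def by blast
  have r: "(x, y) \<in> r \<longleftrightarrow> (\<exists>i j. 1 \<le> i \<and> i < j \<and> j \<le> k \<and> x \<in> C i \<and> y \<in> M j)" for x y
    by (subst \<open>r = _\<close>) simp
  obtain i j where ij: "1 \<le> i" "i < j" "j \<le> k" "x \<in> C i" "x \<in> M j" using x r by blast
  then have "x \<in> C j" using M[of j] by auto
  then show False using column[of i j x] ij by auto
qed

text \<open>Lying above \<open>s\<close> makes both \<open>t\<close> and \<open>x\<close> chosen
  elements. In different columns they are comparable; in the same column they are twins.\<close>

lemma array_taos_comparable:
  assumes "array_taos k n m P r"
    and "(s, t) \<in> r" "(s, x) \<in> r"
  shows "(x, t) \<in> r \<or> (t, x) \<in> r \<or> x \<in> twins P r t"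
proof -
  obtain C M where P: "P = (\<Union>i\<in>{1..k}. C i)"
    and disj: "disjoint_family_on C {1..k}"
    and "\<forall>j. 1 < j \<longrightarrow> j \<le> k \<longrightarrow> M j \<subseteq> C j"
    and "r = {(x, y). \<exists>i j. 1 \<le> i \<and> i < j \<and> j \<le> k \<and> x \<in> C i \<and> y \<in> M j}"
    by (rule array_taos_columns[OF assms(1)])
  then have M: "M j \<subseteq> C j" if "1 < j" "j \<le> k" for j using that by blast
  have column: "i = j" if "i \<in> {1..k}" "j \<in> {1..k}" "x \<in> C i" "x \<in> C j" for i j x
    using disj that unfolding disjoint_family_on_def by blast
  have r: "(x, y) \<in> r \<longleftrightarrow> (\<exists>i j. 1 \<le> i \<and> i < j \<and> j \<le> k \<and> x \<in> C i \<and> y \<in> M j)" for x y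
    by (subst \<open>r = _\<close>) simp
  obtain j where j: "1 < j" "j \<le> k" "t \<in> M j" using assms(2) r by (metis order_le_less_trans)
  obtain l where l: "1 < l" "l \<le> k" "x \<in> M l" using assms(3) r by (metis order_le_less_trans)
  have C: "t \<in> C j" "x \<in> C l" using M j l by auto
  consider "l < j" | "j < l" | "l = j" by linarith
  then show ?thesis
  proof cases
    case 1
    then have "(x, t) \<in> r" using r j l C by (metis less_imp_le_nat)
    then show ?thesis by simp
  next
    case 2
    then have "(t, x) \<in> r" using r j l C by (metis less_imp_le_nat)
    then show ?thesis by simp
  next
    case 3
    \<comment> \<open>What lies above an element depends only on its column; by
      \<open>below\<close>, the same holds for what lies below a chosen element.\<close>
    have above: "(z', y) \<in> r" if z: "z \<in> C j" "z' \<in> C j" "(z, y) \<in> r" for z z' y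
    proof -
      obtain a b where ab: "1 \<le> a" "a < b" "b \<le> k" "z \<in> C a" "y \<in> M b" using z r by blast
      then have "a = j" using j z by (intro column[of a j z]) auto
      then show ?thesis using ab z r by blast
    qed
    have below: "(y, z') \<in> r" if z: "z \<in> M j" "z' \<in> M j" "(y, z) \<in> r" for z z' y
    proof -
      obtain a b where ab: "1 \<le> a" "a < b" "b \<le> k" "y \<in> C a" "z \<in> M b" using z r by blast
      then have "b = j" using j z M[of b] M[of j] by (intro column[of b j z]) auto
      then show ?thesis using ab z r by blast
    qed
    have "x \<in> P" using P C l by auto
    then have "x \<in> twins P r t"
      unfolding twins_def using above[of x t] above[of t x] below[of x t] below[of t x] C j l 3
      by blast
    then show ?thesis by simp
  qed
qed

theorem theorem4p12:
  fixes P :: "'a set" and r :: "'a rel" and k :: nat and n m :: "nat \<Rightarrow> nat"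
  assumes "array_taos k n m P r"
  shows "\<exists>ip :: (('a \<times> 'a) \<Rightarrow>\<^sub>0 real) \<Rightarrow> (('a \<times> 'a) \<Rightarrow>\<^sub>0 real) \<Rightarrow> real.
     inner_product_on (taos_space P r) ip \<and>
     algebraic_ricci_soliton (taos_space P r) taos_bracket ip \<and>
     (\<exists>D\<in>derivations_on (taos_space P r) taos_bracket.
        (\<forall>X\<in>taos_space P r. ricci (taos_space P r) taos_bracket ip X = - X + D X) \<and>
        (\<forall>p\<in>taos_basis P r. \<exists>d::real. D (pair_vec p) = d *\<^sub>R pair_vec p)) \<and>
     (\<forall>p\<in>taos_basis P r. \<forall>q\<in>taos_basis P r. p \<noteq> q \<longrightarrow> ip (pair_vec p) (pair_vec q) = 0) \<and>
     (\<forall>f\<in>taos_aut P r. \<forall>x\<in>taos_space P r. \<forall>y\<in>taos_space P r.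
        ip (taos_action f x) (taos_action f y) = ip x y)"
proof -
  let ?w = "soliton_weight P r"
  have P: "finite P" and taos: "taos P r" by (rule array_taos_imp_taos[OF assms])+
  have r: "r \<subseteq> P \<times> P" "trans r" using taos by (auto simp: taos_def)
  interpret weighted_order P r ?w
  proof
    show "finite r" using P r by (meson finite_SigmaI finite_subset)
    show "soliton_weight P r t > 0" if "(s, t) \<in> r" for s t
      using that r P by (intro soliton_weight_pos) auto
  qed (use r array_taos_irrefl[OF assms] in auto)
  \<comment> \<open>The comparability hypothesis of \<open>ricci_eigenvalue_balanced\<close> holds
    because \<open>t\<close> and \<open>x\<close> share the lower bound \<open>s\<close>.\<close>
  have D: "soliton_derivation \<in> derivations_on (taos_space P r) taos_bracket"
    by (intro soliton_derivation_in_derivations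
        ricci_eigenvalue_balanced[OF weighted_order_axioms P] array_taos_comparable[OF assms])
  have "\<forall>X\<in>taos_space P r. ricci (taos_space P r) taos_bracket weighted_ip X
      = (- 1) *\<^sub>R X + soliton_derivation X"
    by (simp add: ricci_eq)
  then have "algebraic_ricci_soliton (taos_space P r) taos_bracket weighted_ip"
    unfolding algebraic_ricci_soliton_def using metric_lie_algebra D by blast
  moreover have "weighted_ip (taos_action f x) (taos_action f y) = weighted_ip x y"
    if "f \<in> taos_aut P r" "x \<in> taos_space P r" "y \<in> taos_space P r" for f x y
  proof (rule weighted_ip_action)
    show "inj_on f P" using that by (simp add: taos_aut_def bij_betw_def)
  qed (use that soliton_weight_aut r in auto)
  ultimately show ?thesis
    using inner_product D ricci_eq soliton_derivation_pair_vec
    by (intro exI[of _ weighted_ip] conjI bexI[of _ soliton_derivation])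
       (auto simp: weighted_ip_pair_vec)
qed

end
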